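(* There is a numerical constant $C>0$ such that the following holds. Let $w\in A_2^d$, let $b\in BMO^d$, let $m,n\in\mathbb{N}$, and let $\pi_b^{m,n}$ be a dyadic paraproduct of complexity $(m,n)$, that is, $$\pi_b^{m,n}f(x)=\sum_{L\in\mathcal{D}}\ \sum_{\substack{I\in\mathcal{D}_n(L)\\ J\in\mathcal{D}_m(L)}} c^L_{I,J}\, m_If\,\langle b,h_I\rangle\, h_J(x),$$ where the coefficients satisfy $|c^L_{I,J}|\le \sqrt{|I|\,|J|}/|L|$ for all $L\in\mathcal{D}$, $I\in\mathcal{D}_n(L)$, $J\in\mathcal{D}_m(L)$. Then for all $f\in L^2(w)$, $$\|\pi_b^{m,n}f\|_{L^2(w)}\le C\,(m+n+2)^5\,[w]_{A_2^d}\,\|b\|_{BMO^d}\,\|f\|_{L^2(w)}.$$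
   Context: $\mathbb{N}$ includes $0$. $\mathcal{D}$ is the collection of all dyadic intervals $[k2^{-j},(k+1)2^{-j})\subset\mathbb{R}$, $j,k\in\mathbb{Z}$. For $L\in\mathcal{D}$, $\mathcal{D}(L)$ is the set of dyadic intervals contained in $L$ and $\mathcal{D}_n(L)=\{I\in\mathcal{D}(L): |I|=2^{-n}|L|\}$, where $|I|$ is the length of $I$. For an interval $I$, $m_If=\frac1{|I|}\int_I f(x)\,dx$. The Haar function of $I\in\mathcal{D}$ is $h_I=|I|^{-1/2}(\chi_{I_+}-\chi_{I_-})$, where $I_+,I_-$ are the right and left halves of $I$, and $\langle f,g\rangle=\int_{\mathbb{R}} f\overline{g}\,dx$. A weight is a locally integrable function on $\mathbb{R}$ that is positive almost everywhere. $L^2(w)$ is the space of measurable functions with $\|f\|_{L^2(w)}=\left(\int_{\mathbb{R}}|f|^2w\,dx\right)^{1/2}<\infty$. A weight $w$ belongs to $A_2^d$ if $[w]_{A_2^d}:=\sup_{I\in\mathcal{D}}(m_Iw)(m_Iw^{-1})<\infty$. A locally integrable function $b$ belongs to $BMO^d$ if $\|b\|_{BMO^d}:=\left(\sup_{J\in\mathcal{D}}\frac1{|J|}\sum_{I\in\mathcal{D}(J)}|\langle b,h_I\rangle|^2\right)^{1/2}<\infty$. *)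

theory Defs
  imports "HOL-Analysis.Analysis"
begin

definition dyadic :: "real set set" where
  "dyadic = {{of_int k * 2 powi (- j) ..< of_int (k + 1) * 2 powi (- j)} | j k :: int. True}"

definition dyadic_sub :: "real set \<Rightarrow> real set set" where
  "dyadic_sub L = {I \<in> dyadic. I \<subseteq> L}"

definition ilen :: "real set \<Rightarrow> real" where
  "ilen I = measure lebesgue I"

definition dyadic_gen :: "nat \<Rightarrow> real set \<Rightarrow> real set set" where
  "dyadic_gen n L = {I \<in> dyadic_sub L. ilen I = ilen L / 2 ^ n}"

definition mean :: "real set \<Rightarrow> (real \<Rightarrow> complex) \<Rightarrow> complex" where
  "mean I f = (LINT x:I|lebesgue. f x) / of_real (ilen I)"

definition right_half :: "real set \<Rightarrow> real set" where
  "right_half I = {x \<in> I. (Inf I + Sup I) / 2 \<le> x}"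

definition left_half :: "real set \<Rightarrow> real set" where
  "left_half I = {x \<in> I. x < (Inf I + Sup I) / 2}"

definition haar :: "real set \<Rightarrow> real \<Rightarrow> complex" where
  "haar I x = (indicator (right_half I) x - indicator (left_half I) x) / of_real (sqrt (ilen I))"

definition pairing :: "(real \<Rightarrow> complex) \<Rightarrow> (real \<Rightarrow> complex) \<Rightarrow> complex" where
  "pairing f g = (LINT x|lebesgue. f x * cnj (g x))"

definition locally_integrable :: "(real \<Rightarrow> 'a::{banach, second_countable_topology}) \<Rightarrow> bool" where
  "locally_integrable f \<longleftrightarrow> (\<forall>K. compact K \<longrightarrow> set_integrable lebesgue K f)"

definition weight :: "(real \<Rightarrow> real) \<Rightarrow> bool" where
  "weight w \<longleftrightarrow> locally_integrable w \<and> (AE x in lebesgue. 0 < w x)"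

definition L2w :: "(real \<Rightarrow> real) \<Rightarrow> (real \<Rightarrow> complex) set" where
  "L2w w = {f \<in> borel_measurable lebesgue. integrable lebesgue (\<lambda>x. (cmod (f x))\<^sup>2 * w x)}"

definition L2w_norm :: "(real \<Rightarrow> real) \<Rightarrow> (real \<Rightarrow> complex) \<Rightarrow> real" where
  "L2w_norm w f = sqrt (LINT x|lebesgue. (cmod (f x))\<^sup>2 * w x)"

(* The Bochner integral of a non-integrable function is 0, so the means of the weight and
   of its reciprocal are taken with values in [0,\<infinity>]; finiteness of the supremum then
   forces the reciprocal of a weight to be integrable on every dyadic interval. *)
definition ext_mean :: "real set \<Rightarrow> (real \<Rightarrow> real) \<Rightarrow> ennreal" where
  "ext_mean I u = (\<integral>\<^sup>+x\<in>I. ennreal (u x) \<partial>lebesgue) / ennreal (ilen I)"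

definition A2_sup :: "(real \<Rightarrow> real) \<Rightarrow> ennreal" where
  "A2_sup w = (SUP I\<in>dyadic. ext_mean I w * ext_mean I (\<lambda>x. inverse (w x)))"

definition A2d :: "(real \<Rightarrow> real) set" where
  "A2d = {w. weight w \<and> A2_sup w < \<infinity>}"

definition A2_char :: "(real \<Rightarrow> real) \<Rightarrow> real" where
  "A2_char w = enn2real (A2_sup w)"

definition BMO_sup :: "(real \<Rightarrow> complex) \<Rightarrow> ennreal" where
  "BMO_sup b = (SUP J\<in>dyadic.
     (\<Sum>\<^sub>\<infinity>I\<in>dyadic_sub J. ennreal ((cmod (pairing b (haar I)))\<^sup>2)) / ennreal (ilen J))"

definition BMOd :: "(real \<Rightarrow> complex) set" where
  "BMOd = {b. locally_integrable b \<and> BMO_sup b < \<infinity>}"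

definition BMO_norm :: "(real \<Rightarrow> complex) \<Rightarrow> real" where
  "BMO_norm b = sqrt (enn2real (BMO_sup b))"

(* c L I J stands for the coefficient with upper index L and lower indices I, J;
   its values matter only for I in generation n and J in generation m below L. *)
definition admissible_coeffs ::
    "nat \<Rightarrow> nat \<Rightarrow> (real set \<Rightarrow> real set \<Rightarrow> real set \<Rightarrow> complex) \<Rightarrow> bool" where
  "admissible_coeffs m n c \<longleftrightarrow>
     (\<forall>L\<in>dyadic. \<forall>I\<in>dyadic_gen n L. \<forall>J\<in>dyadic_gen m L.
        cmod (c L I J) \<le> sqrt (ilen I * ilen J) / ilen L)"

definition paraproduct_term ::
    "nat \<Rightarrow> nat \<Rightarrow> (real set \<Rightarrow> real set \<Rightarrow> real set \<Rightarrow> complex) \<Rightarrow> (real \<Rightarrow> complex) \<Rightarrow>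
     (real \<Rightarrow> complex) \<Rightarrow> real set \<Rightarrow> real \<Rightarrow> complex" where
  "paraproduct_term m n c b f L x =
     (\<Sum>I\<in>dyadic_gen n L. \<Sum>J\<in>dyadic_gen m L.
        c L I J * mean I f * pairing b (haar I) * haar J x)"

(* g represents the paraproduct applied to f: the series over all dyadic L converges
   unconditionally to g in L2(w), i.e. along the net of finite subsets of dyadic.
   (Pointwise the series need not converge absolutely, and the index set carries no order.)
   Such a g is unique up to equality almost everywhere. *)
definition is_paraproduct ::
    "(real \<Rightarrow> real) \<Rightarrow> nat \<Rightarrow> nat \<Rightarrow> (real set \<Rightarrow> real set \<Rightarrow> real set \<Rightarrow> complex) \<Rightarrow>
     (real \<Rightarrow> complex) \<Rightarrow> (real \<Rightarrow> complex) \<Rightarrow> (real \<Rightarrow> complex) \<Rightarrow> bool" where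
  "is_paraproduct w m n c b f g \<longleftrightarrow>
     g \<in> L2w w \<and>
     ((\<lambda>F. L2w_norm w (\<lambda>x. g x - (\<Sum>L\<in>F. paraproduct_term m n c b f L x))) \<longlongrightarrow> 0)
       (finite_subsets_at_top dyadic)"

end

theory Submission
  imports Defs
begin

text \<open>
  Put \<open>\<sigma> = 1/w\<close> and let \<open>h\<close> be a finite partial sum of the paraproduct.  Testing \<open>h\<close> against
  \<open>g = h w\<close> writes the square of its norm in \<open>L2(w)\<close> as the integral of \<open>h cnj g\<close>, and the bound on
  the coefficients separates the two functions: that integral is at most the sum over \<open>L\<close> of
  \<open>A L * B L\<close>, where \<open>A L\<close> is the sum of \<open>sqrt |I| * |m_I f| * |<b,h_I>|\<close> over the \<open>I\<close> lying \<open>n\<close>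
  generations below \<open>L\<close>, divided by \<open>sqrt |L|\<close>, and \<open>B L\<close> is the same expression for
  \<open>|<g,h_J>|\<close> and \<open>m\<close> generations.  As the norm of \<open>g\<close> in \<open>L2(\<sigma>)\<close> is the norm of \<open>h\<close> in \<open>L2(w)\<close>,
  everything follows from the estimate of this sum by \<open>(m+n+2) [w] ||b|| ||f|| ||g||\<close>, with the
  norms of \<open>L2(w)\<close> and \<open>L2(\<sigma>)\<close> on the right (\<open>bilinear_estimate\<close>).

  Local part (\<open>local_estimate\<close>).  Inside an interval \<open>Q0\<close> stop at the maximal subintervals on which
  the average of \<open>|f|\<close> or of \<open>|g|\<close> exceeds four times its average over \<open>Q0\<close>.  The sum of \<open>A L * B L\<close>
  over the \<open>L\<close> that no stopping interval contains is at most a constant times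
  \<open>(m+n+2) ||b|| F(Q0) G(Q0) / |Q0|\<close>, where \<open>F\<close> and \<open>G\<close> are the integrals of \<open>|f|\<close> and \<open>|g|\<close>.
  Indeed, by the Cauchy-Schwarz inequality it is enough to sum the squares of \<open>A L\<close> and of \<open>B L\<close>.
  The contribution of the \<open>I\<close> outside all stopping intervals is controlled by the packing condition
  for \<open>b\<close>, as the averages of \<open>f\<close> over them are small; for \<open>g\<close> a telescoping sum plays the role of the
  packing condition.  An \<open>I\<close> inside a stopping interval \<open>Q\<close> is estimated by the integral over \<open>I\<close>
  alone, and since then \<open>Q\<close> lies strictly inside \<open>L\<close>, at most \<open>n\<close> generations down, each \<open>Q\<close> is
  counted at most \<open>n+1\<close> times; the \<open>J\<close> are treated in the same way with \<open>m\<close> for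
  \<open>n\<close>.  This is where the complexity enters, and only linearly.

  Global part (\<open>bellman_induction\<close>).  The local bounds are added up by an induction on scales.  For
  \<open>P\<close> the integral of \<open>|f|^2 w\<close>, the quantity \<open>U(Q) = P(Q) - F(Q)^2 / (2 \<sigma>(Q))\<close> is nonnegative and
  exceeds the sum of its values over the stopping intervals by at least
  \<open>(F(Q0) / \<sigma>(Q0))^2 \<sigma>(E) / 4\<close>, where \<open>E\<close> is \<open>Q0\<close> without its stopping intervals
  (\<open>energy_step\<close>); the same holds for \<open>g\<close> with \<open>w\<close> in place of \<open>\<sigma>\<close>.  With \<open>\<alpha> = F(Q0) / \<sigma>(Q0)\<close>
  and \<open>\<beta> = G(Q0) / w(Q0)\<close> the A2 condition and \<open>|Q0| \<le> 2 |E|\<close> give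
  \<open>F(Q0) G(Q0) / |Q0| \<le> [w] \<alpha> \<beta> |Q0| \<le> 2 [w] \<alpha> \<beta> |E| \<le> [w] (s \<alpha>^2 \<sigma>(E) + \<beta>^2 w(E) / s)\<close> for every
  \<open>s > 0\<close>, because \<open>\<sigma> w = 1\<close>.  So each local bound is paid for by the gain in energy, with
  only one factor \<open>[w]\<close>, and an optimal \<open>s\<close> produces the product of the two norms.

  Convergence.  The bound for finite partial sums is unaffected by changes of sign of the terms.  If
  the series failed to converge unconditionally, there would be arbitrarily many disjoint blocks of
  norm at least \<open>e\<close>; by the parallelogram law signs can be chosen so that the squares of their norms add
  up, contradicting the bound (\<open>unconditional_tail\<close>).  Completeness of \<open>L2(w)\<close> then yields the sum.
\<close>

section \<open>Geometry of dyadic intervals\<close>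

definition dyad :: "int \<Rightarrow> int \<Rightarrow> real set" where
  "dyad j k = {of_int k * 2 powi (- j) ..< of_int (k + 1) * 2 powi (- j)}"

lemma dyadic_iff: "I \<in> dyadic \<longleftrightarrow> (\<exists>j k. I = dyad j k)"
  by (auto simp: dyadic_def dyad_def)

text \<open>With this description the inclusion relations between dyadic intervals become the integer division of
\<open>floor_scale\<close>.\<close>

lemma mem_dyad_iff: "x \<in> dyad j k \<longleftrightarrow> \<lfloor>x * 2 powi j\<rfloor> = k"
proof -
  have p: "(0::real) < 2 powi j" by simp
  have "of_int k * 2 powi (- j) \<le> x \<longleftrightarrow> of_int k \<le> x * 2 powi j"
    "x < of_int (k + 1) * 2 powi (- j) \<longleftrightarrow> x * 2 powi j < of_int (k + 1)"
    using p by (simp_all add: power_int_minus field_simps)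
  then show ?thesis
    unfolding dyad_def by (auto simp: floor_eq_iff)
qed

lemma ilen_dyad: "ilen (dyad j k) = 2 powi (- j)"
  unfolding ilen_def dyad_def by (simp add: measure_completion algebra_simps)

lemma dyad_nonempty: "dyad j k \<noteq> {}"
  unfolding dyad_def by (simp add: mult_strict_right_mono)

lemma powi_neg_add: "(2::real) powi (- (j + int n)) = 2 powi (- j) / 2 ^ n"
  by (simp only: minus_add_distrib power_int_add[OF disjI1] zero_neq_numeral[symmetric] not_False_eq_True)
    (simp add: power_int_minus field_simps)

lemma floor_scale:
  fixes x :: real
  shows "\<lfloor>x * 2 powi j\<rfloor> = \<lfloor>x * 2 powi (j + int n)\<rfloor> div 2 ^ n"
proof -
  have "x * 2 powi j = (x * 2 powi (j + int n)) / real_of_int (2 ^ n)"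
    by (subst power_int_add) simp_all
  then show ?thesis
    by (metis floor_divide_real_eq_div zero_le_numeral zero_le_power)
qed

lemma dyad_eq_UN: "dyad j k = (\<Union>k'\<in>{k'. k' div 2 ^ n = k}. dyad (j + int n) k')"
  by (auto simp: mem_dyad_iff floor_scale[of _ j n])

lemma dyad_nested:
  assumes "x \<in> dyad j k" "x \<in> dyad j' k'" "j \<le> j'"
  shows "dyad j' k' \<subseteq> dyad j k"
proof -
  define n where "n = nat (j' - j)"
  have j': "j' = j + int n" using assms(3) by (simp add: n_def)
  have "k = k' div 2 ^ n"
    using assms floor_scale[of x j n] unfolding j' mem_dyad_iff by simp
  then show ?thesis
    unfolding j' dyad_eq_UN[of j k n] by blast
qed

lemma dyadic_nonempty: "I \<in> dyadic \<Longrightarrow> I \<noteq> {}"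
  by (auto simp: dyadic_iff dyad_nonempty)

lemma ilen_pos: "I \<in> dyadic \<Longrightarrow> 0 < ilen I"
  by (auto simp: dyadic_iff ilen_dyad)

lemma dyadic_sets [simp]: "I \<in> dyadic \<Longrightarrow> I \<in> sets lebesgue"
  by (auto simp: dyadic_iff dyad_def)

lemma dyadic_emeasure: "I \<in> dyadic \<Longrightarrow> emeasure lebesgue I = ennreal (ilen I)"
  by (auto simp: dyadic_iff ilen_def measure_completion dyad_def mult_right_mono)

lemma dyadic_in_compact:
  assumes "I \<in> dyadic" obtains K where "compact K" "I \<subseteq> K"
proof -
  obtain j k where I: "I = dyad j k" using assms by (auto simp: dyadic_iff)
  have "I \<subseteq> {of_int k * 2 powi (- j)..of_int (k + 1) * 2 powi (- j)}"
    unfolding I dyad_def by auto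
  then show thesis using that compact_Icc by blast
qed

lemma dyadic_nested:
  assumes "I \<in> dyadic" "J \<in> dyadic" "x \<in> I" "x \<in> J" "ilen I \<le> ilen J"
  shows "I \<subseteq> J"
proof -
  obtain j k j' k' where e: "J = dyad j k" "I = dyad j' k'"
    using assms by (auto simp: dyadic_iff)
  have "j \<le> j'"
  proof (rule ccontr)
    assume "\<not> ?thesis"
    then have "(2::real) powi (- j) < 2 powi (- j')"
      by (intro power_int_strict_increasing) auto
    then show False using assms(5) by (simp add: e ilen_dyad)
  qed
  then show ?thesis using dyad_nested assms(3,4) e by blast
qed

lemma dyadic_psubset_if_meets:
  assumes "I \<in> dyadic" "J \<in> dyadic" "\<not> J \<subseteq> I" "I \<inter> J \<noteq> {}"
  shows "I \<subset> J"
  using assms dyadic_nested[of I J] dyadic_nested[of J I] by (metis disjoint_iff linear psubsetI)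

lemma dyadic_ilen_mono:
  assumes "I \<in> dyadic" "J \<in> dyadic" "I \<subseteq> J"
  shows "ilen I \<le> ilen J"
  using assms dyadic_emeasure unfolding ilen_def
  by (intro measure_mono_fmeasurable) (auto simp: fmeasurable_def)

lemma dyadic_eqI:
  assumes "I \<in> dyadic" "J \<in> dyadic" "x \<in> I" "x \<in> J" "ilen I = ilen J"
  shows "I = J"
  using assms dyadic_nested[of I J x] dyadic_nested[of J I x] by auto

lemma dyadic_gen_dyad: "dyadic_gen n (dyad j k) = dyad (j + int n) ` {k'. k' div 2 ^ n = k}"
proof
  show "dyadic_gen n (dyad j k) \<subseteq> dyad (j + int n) ` {k'. k' div 2 ^ n = k}"
  proof
    fix I assume I: "I \<in> dyadic_gen n (dyad j k)"
    then obtain j' k' where e: "I = dyad j' k'" and s: "I \<subseteq> dyad j k"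
      by (auto simp: dyadic_gen_def dyadic_sub_def dyadic_iff)
    have "(2::real) powi (- j') = 2 powi (- (j + int n))"
      using I by (simp only: dyadic_gen_def mem_Collect_eq e ilen_dyad powi_neg_add)
    then have j': "j' = j + int n"
      using power_int_strict_increasing[of "- j'" "- (j + int n)" "2::real"]
        power_int_strict_increasing[of "- (j + int n)" "- j'" "2::real"] by linarith
    obtain x where x: "x \<in> I" using dyad_nonempty e by blast
    then have "k' div 2 ^ n = k"
      using s floor_scale[of x j n] unfolding e j' by (auto simp: mem_dyad_iff)
    then show "I \<in> dyad (j + int n) ` {k'. k' div 2 ^ n = k}"
      using e j' by auto
  qed
  show "dyad (j + int n) ` {k'. k' div 2 ^ n = k} \<subseteq> dyadic_gen n (dyad j k)"
  proof clarify
    fix k' assume "k = k' div 2 ^ n"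
    then have "dyad (j + int n) k' \<subseteq> dyad j (k' div 2 ^ n)"
      by (auto simp: dyad_eq_UN[of j _ n])
    then show "dyad (j + int n) k' \<in> dyadic_gen n (dyad j (k' div 2 ^ n))"
      by (auto simp: dyadic_gen_def dyadic_sub_def dyadic_iff ilen_dyad powi_neg_add simp del: minus_add_distrib)
  qed
qed

lemma finite_div_eq: "finite {k'::int. k' div 2 ^ n = k}"
proof (rule finite_subset)
  show "{k'::int. k' div 2 ^ n = k} \<subseteq> {k * 2 ^ n .. (k + 1) * 2 ^ n}"
  proof clarify
    fix k' :: int
    have "k' = (k' div 2 ^ n) * 2 ^ n + k' mod 2 ^ n" by (rule div_mult_mod_eq[symmetric])
    moreover have "0 \<le> k' mod 2 ^ n" "k' mod 2 ^ n < 2 ^ n" by auto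
    ultimately have "(k' div 2 ^ n) * 2 ^ n \<le> k'" "k' \<le> (k' div 2 ^ n) * 2 ^ n + 2 ^ n" by linarith+
    then show "k' \<in> {(k' div 2 ^ n) * 2 ^ n .. (k' div 2 ^ n + 1) * 2 ^ n}"
      by (auto simp: algebra_simps) 
  qed
qed simp

lemma dyadic_genD:
  assumes "I \<in> dyadic_gen n L"
  shows "I \<in> dyadic" "I \<subseteq> L" "ilen I = ilen L / 2 ^ n"
  using assms by (auto simp: dyadic_gen_def dyadic_sub_def)

lemma finite_dyadic_gen [simp]: "L \<in> dyadic \<Longrightarrow> finite (dyadic_gen n L)"
  by (auto simp: dyadic_iff dyadic_gen_dyad finite_div_eq)

lemma disjoint_dyadic_gen: "disjoint (dyadic_gen n L)"
  unfolding disjoint_def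
proof (intro ballI impI)
  fix I J assume "I \<in> dyadic_gen n L" "J \<in> dyadic_gen n L" "I \<noteq> J"
  then show "I \<inter> J = {}"
    using dyadic_eqI[of I J] dyadic_genD[of I n L] dyadic_genD[of J n L] by auto
qed

lemma dyadic_parent:
  assumes "I \<in> dyadic" obtains P where "P \<in> dyadic" "I \<in> dyadic_gen 1 P"
proof -
  obtain j k where I: "I = dyad j k" using assms by (auto simp: dyadic_iff)
  have "I \<in> dyadic_gen 1 (dyad (j - 1) (k div 2))"
    unfolding I dyadic_gen_dyad by auto
  then show thesis using that by (auto simp: dyadic_iff)
qed

lemma dyadic_ilen_ratio:
  assumes "I \<in> dyadic" "J \<in> dyadic" "ilen I \<le> ilen J"
  obtains n where "ilen I = ilen J / 2 ^ n"
proof -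
  obtain j k j' k' where e: "J = dyad j k" "I = dyad j' k'"
    using assms by (auto simp: dyadic_iff)
  have "j \<le> j'"
  proof (rule ccontr)
    assume "\<not> ?thesis"
    then have "(2::real) powi (- j) < 2 powi (- j')"
      by (intro power_int_strict_increasing) auto
    then show False using assms by (simp add: e ilen_dyad)
  qed
  then have "j' = j + int (nat (j' - j))" by simp
  then obtain n where "j' = j + int n" by blast
  then have "ilen I = ilen J / 2 ^ n"
    by (simp only: e ilen_dyad powi_neg_add)
  then show thesis by (rule that)
qed

lemma dyadic_sub_gen:
  assumes "I \<in> dyadic" "J \<in> dyadic" "I \<subseteq> J"
  obtains n where "I \<in> dyadic_gen n J"
  using dyadic_ilen_ratio[of I J] dyadic_ilen_mono[of I J] assms
  unfolding dyadic_gen_def dyadic_sub_def by blast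

text \<open>Stopping intervals are selected among intervals of length at least \<open>\<delta>\<close>; this keeps the selection
finite and guarantees maximal elements.\<close>

lemma finite_dyadic_sub_ge:
  assumes "J \<in> dyadic" "0 < \<delta>"
  shows "finite {I \<in> dyadic_sub J. \<delta> \<le> ilen I}"
proof -
  obtain N where N: "ilen J / \<delta> < 2 ^ N" using real_arch_pow[of 2] by force
  have "{I \<in> dyadic_sub J. \<delta> \<le> ilen I} \<subseteq> (\<Union>n\<le>N. dyadic_gen n J)"
  proof clarify
    fix I assume "I \<in> dyadic_sub J" and d: "\<delta> \<le> ilen I"
    then obtain n where n: "I \<in> dyadic_gen n J"
      using dyadic_sub_gen assms(1) by (auto simp: dyadic_sub_def)
    then have "\<delta> * 2 ^ n \<le> ilen J" using d by (auto dest!: dyadic_genD(3) simp: field_simps)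
    then have "(2::real) ^ n < 2 ^ N" using N assms(2) by (smt (verit) divide_less_eq mult.commute mult_less_cancel_left)
    then have "n \<le> N" by simp
    then show "I \<in> (\<Union>n\<le>N. dyadic_gen n J)" using n by auto
  qed
  then show ?thesis by (rule finite_subset) (simp add: assms(1))
qed

text \<open>The intervals containing \<open>Q\<close> form a chain, so they are determined by their lengths, which are
\<open>2 ^ i * ilen Q\<close> with \<open>i \<le> n\<close>.\<close>

lemma card_dyadic_ancestors:
  assumes "Q \<in> dyadic" "\<A> \<subseteq> dyadic" "\<And>L. L \<in> \<A> \<Longrightarrow> Q \<subseteq> L \<and> ilen L \<le> 2 ^ n * ilen Q"
  shows "finite \<A>" "card \<A> \<le> n + 1"
proof -
  obtain x where x: "x \<in> Q" using assms(1) dyadic_nonempty by blast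
  have inj: "inj_on ilen \<A>"
    using dyadic_eqI[of _ _ x] assms(2,3) x by (intro inj_onI) blast
  have sub: "ilen ` \<A> \<subseteq> (\<lambda>i. 2 ^ i * ilen Q) ` {..n}"
  proof clarify
    fix L assume L: "L \<in> \<A>"
    then obtain i where i: "ilen Q = ilen L / 2 ^ i"
      using dyadic_ilen_ratio[of Q L] dyadic_ilen_mono[of Q L] assms by blast
    then have "2 ^ i * ilen Q \<le> 2 ^ n * ilen Q" using assms(3)[OF L] by (simp add: field_simps)
    then have "(2::real) ^ i \<le> 2 ^ n" using ilen_pos[OF assms(1)] by simp
    then have "i \<le> n" by simp
    then show "ilen L \<in> (\<lambda>i. 2 ^ i * ilen Q) ` {..n}" using i by (intro image_eqI[of _ _ i]) (auto simp: field_simps)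
  qed
  have "finite (ilen ` \<A>)" using sub by (rule finite_subset) simp
  then show fin: "finite \<A>" using inj finite_imageD by blast
  have "card \<A> = card (ilen ` \<A>)" using inj by (simp add: card_image)
  also have "\<dots> \<le> card ((\<lambda>i. 2 ^ i * ilen Q) ` {..n})" by (rule card_mono[OF _ sub]) simp
  also have "\<dots> \<le> card {..n}" by (rule card_image_le) simp
  finally show "card \<A> \<le> n + 1" by simp
qed

lemma halves_dyad:
  "left_half (dyad j k) = dyad (j + 1) (2 * k)" "right_half (dyad j k) = dyad (j + 1) (2 * k + 1)"
proof -
  define h :: real where "h = 2 powi (- (j + 1))"
  have h: "h > 0" "(2::real) powi (- j) = 2 * h"
    using powi_neg_add[of j 1] by (simp_all add: h_def del: minus_add_distrib)
  have d: "dyad j k = {of_int k * (2 * h)..<of_int (k + 1) * (2 * h)}"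
    unfolding dyad_def h(2) ..
  have lt: "of_int k * (2 * h) < of_int (k + 1) * (2 * h)" using h by simp
  have m: "(Inf (dyad j k) + Sup (dyad j k)) / 2 = of_int (2 * k + 1) * h"
    unfolding d using lt by (simp add: field_simps)
  have d': "dyad (j + 1) k' = {of_int k' * h..<of_int (k' + 1) * h}" for k'
    unfolding dyad_def h_def ..
  show "left_half (dyad j k) = dyad (j + 1) (2 * k)"
    unfolding left_half_def m d' d using h by (auto simp: field_simps)
  show "right_half (dyad j k) = dyad (j + 1) (2 * k + 1)"
    unfolding right_half_def m d' d using h by (auto simp: field_simps)
qed

lemma dyadic_gen_1:
  assumes "L \<in> dyadic"
  shows "dyadic_gen 1 L = {left_half L, right_half L}" "left_half L \<inter> right_half L = {}"
    "left_half L \<union> right_half L = L"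
proof -
  obtain j k where L: "L = dyad j k" using assms by (auto simp: dyadic_iff)
  have "{k'. k' div 2 = k} = {2 * k, 2 * k + 1}" by auto
  then show "dyadic_gen 1 L = {left_half L, right_half L}"
    unfolding L dyadic_gen_dyad halves_dyad by simp
qed (auto simp: left_half_def right_half_def)

lemma half_dyadic:
  assumes "L \<in> dyadic"
  shows "left_half L \<in> dyadic" "right_half L \<in> dyadic" "left_half L \<subseteq> L" "right_half L \<subseteq> L"
    "ilen (left_half L) = ilen L / 2" "ilen (right_half L) = ilen L / 2"
  using dyadic_gen_1[OF assms] dyadic_genD[of "left_half L" 1 L] dyadic_genD[of "right_half L" 1 L]
  by auto

text \<open>The basis of all inductions on scales: below \<open>L\<close> itself, the dyadic subintervals of \<open>L\<close> split into
those of the two halves.\<close>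

lemma dyadic_psubset_half:
  assumes "L \<in> dyadic" "I \<in> dyadic" "I \<subset> L"
  shows "I \<subseteq> left_half L \<or> I \<subseteq> right_half L"
proof -
  obtain x where x: "x \<in> I" using assms(2) dyadic_nonempty by blast
  obtain n where n: "I \<in> dyadic_gen n L" using dyadic_sub_gen assms by blast
  have "n \<noteq> 0"
  proof
    assume "n = 0"
    then have "ilen I = ilen L" using dyadic_genD(3)[OF n] by simp
    then show False using dyadic_eqI[of I L x] assms x by auto
  qed
  then have "(2::real) \<le> 2 ^ n" by (cases n) simp_all
  then have "ilen I \<le> ilen L / 2" using dyadic_genD(3)[OF n] ilen_pos[OF assms(1)]
    using divide_left_mono[of 2 "2 ^ n" "ilen L"] by simp
  moreover have "x \<in> left_half L \<or> x \<in> right_half L" using dyadic_gen_1(3)[OF assms(1)] x assms(3) by auto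
  ultimately show ?thesis using dyadic_nested[of I _ x] x half_dyadic[OF assms(1)] assms by metis
qed

lemma dyadic_maximal_elements:
  assumes "finite \<F>" "\<F> \<subseteq> dyadic"
  obtains \<M> where "\<M> \<subseteq> \<F>" "disjoint \<M>" "\<And>L. L \<in> \<F> \<Longrightarrow> \<exists>Q\<in>\<M>. L \<subseteq> Q"
    "\<And>Q L. Q \<in> \<M> \<Longrightarrow> L \<in> \<F> \<Longrightarrow> Q \<subseteq> L \<Longrightarrow> L = Q"
proof
  let ?M = "{Q \<in> \<F>. \<forall>L\<in>\<F>. Q \<subseteq> L \<longrightarrow> L = Q}"
  show "?M \<subseteq> \<F>" by auto
  show "disjoint ?M"
    unfolding disjoint_def
  proof (intro ballI impI)
    fix I J assume "I \<in> ?M" "J \<in> ?M" "I \<noteq> J"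
    then show "I \<inter> J = {}"
      using dyadic_psubset_if_meets[of I J] assms(2) by auto
  qed
  show "\<exists>Q\<in>?M. L \<subseteq> Q" if "L \<in> \<F>" for L
    using finite_has_maximal2[OF assms(1) that] by auto
qed auto

section \<open>Square sums outside a stopping family\<close>

text \<open>Local integrability in dyadic terms; it is shared by \<open>w\<close>, by \<open>1/w\<close> for a weight in the dyadic A2 class,
and by the functions in \<open>L2(w)\<close>.\<close>

definition dyadic_integrable :: "(real \<Rightarrow> 'a::{banach, second_countable_topology}) \<Rightarrow> bool" where
  "dyadic_integrable u \<longleftrightarrow> (\<forall>I\<in>dyadic. set_integrable lebesgue I u)"

abbreviation mass :: "(real \<Rightarrow> 'a::{banach, second_countable_topology}) \<Rightarrow> real set \<Rightarrow> 'a" where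
  "mass u A \<equiv> (LINT x:A|lebesgue. u x)"

lemma dyadic_integrableD: "dyadic_integrable u \<Longrightarrow> I \<in> dyadic \<Longrightarrow> set_integrable lebesgue I u"
  by (simp add: dyadic_integrable_def)

lemma dyadic_integrable_one: "dyadic_integrable (\<lambda>_. 1 :: real)"
  unfolding dyadic_integrable_def set_integrable_def
proof
  fix I :: "real set" assume I: "I \<in> dyadic"
  have "emeasure lebesgue I < \<infinity>"
    unfolding dyadic_emeasure[OF I] by simp
  then show "integrable lebesgue (\<lambda>x. indicat_real I x *\<^sub>R (1 :: real))"
    using integrable_real_indicator[of I lebesgue] I by simp
qed

lemma mass_one: "I \<in> dyadic \<Longrightarrow> mass (\<lambda>_. 1 :: real) I = ilen I"
  by (simp add: ilen_def set_lebesgue_integral_def)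

lemma mass_nonneg: "(\<And>x. 0 \<le> u x) \<Longrightarrow> 0 \<le> mass (u :: real \<Rightarrow> real) A"
  unfolding set_lebesgue_integral_def by (intro integral_nonneg_AE) auto

lemma mass_subset_mono:
  fixes u :: "real \<Rightarrow> real"
  assumes "set_integrable lebesgue B u" "A \<in> sets lebesgue" "A \<subseteq> B" "\<And>x. 0 \<le> u x"
  shows "mass u A \<le> mass u B"
proof -
  have "set_integrable lebesgue A u" by (rule set_integrable_subset[OF assms(1-3)])
  then show ?thesis
    using assms unfolding set_lebesgue_integral_def set_integrable_def
    by (intro integral_mono) (auto split: split_indicator)
qed

lemma mass_Union:
  assumes "finite \<M>" "\<M> \<subseteq> dyadic" "disjoint \<M>" "dyadic_integrable u"
  shows "mass u (\<Union>\<M>) = (\<Sum>Q\<in>\<M>. mass u Q)" "set_integrable lebesgue (\<Union>\<M>) u" "\<Union>\<M> \<in> sets lebesgue"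
proof -
  have d: "disjoint_family_on (\<lambda>x. x) \<M>"
    using assms(3) by (auto simp: disjoint_family_on_def disjoint_def)
  have i: "set_integrable lebesgue Q u" if "Q \<in> \<M>" for Q
    using assms that dyadic_integrableD by blast
  have s: "Q \<in> sets lebesgue" if "Q \<in> \<M>" for Q using that assms by auto
  show "mass u (\<Union>\<M>) = (\<Sum>Q\<in>\<M>. mass u Q)"
    using set_integral_finite_Union[OF assms(1) d i s] by simp
  show "set_integrable lebesgue (\<Union>\<M>) u"
    using set_integrable_UN[of \<M> lebesgue "\<lambda>x. x" u, OF assms(1) i s] by simp
  show "\<Union>\<M> \<in> sets lebesgue" using assms(1) s by blast
qed

lemma mass_Union_mono:
  fixes u :: "real \<Rightarrow> real"
  assumes "finite \<M>" "\<M> \<subseteq> dyadic" "disjoint \<M>" "finite \<N>" "\<N> \<subseteq> dyadic" "disjoint \<N>"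
    "\<Union>\<M> \<subseteq> \<Union>\<N>" "dyadic_integrable u" "\<And>x. 0 \<le> u x"
  shows "(\<Sum>Q\<in>\<M>. mass u Q) \<le> (\<Sum>Q\<in>\<N>. mass u Q)"
  using mass_subset_mono[of "\<Union>\<N>" u "\<Union>\<M>"] mass_Union[OF assms(1-3,8)] mass_Union[OF assms(4-6,8)] assms(7,9)
  by auto

lemma ilen_Union_mono:
  assumes "finite \<M>" "\<M> \<subseteq> dyadic" "disjoint \<M>" "finite \<N>" "\<N> \<subseteq> dyadic" "disjoint \<N>" "\<Union>\<M> \<subseteq> \<Union>\<N>"
  shows "(\<Sum>Q\<in>\<M>. ilen Q) \<le> (\<Sum>Q\<in>\<N>. ilen Q)"
proof -
  have "(\<Sum>Q\<in>\<F>. ilen Q) = (\<Sum>Q\<in>\<F>. mass (\<lambda>_. 1 :: real) Q)" if "\<F> \<subseteq> dyadic" for \<F>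
    using that by (intro sum.cong refl mass_one[symmetric]) auto
  then show ?thesis
    using mass_Union_mono[OF assms dyadic_integrable_one] assms by simp
qed

lemma mass_split:
  fixes u :: "real \<Rightarrow> 'a::{banach, second_countable_topology}"
  assumes "finite \<M>" "\<M> \<subseteq> dyadic" "disjoint \<M>" "\<Union>\<M> \<subseteq> Q" "Q \<in> dyadic" "dyadic_integrable u"
  shows "mass u Q = mass u (Q - \<Union>\<M>) + (\<Sum>R\<in>\<M>. mass u R)"
proof -
  note M = mass_Union[OF assms(1-3,6)]
  have "set_integrable lebesgue (Q - \<Union>\<M>) u"
    by (rule set_integrable_subset[OF dyadic_integrableD[OF assms(6,5)]]) (use M assms in auto)
  from set_integral_Un[OF _ this M(2)] M(1) assms(4) show ?thesis
    by (simp add: Un_absorb2 Int_commute)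
qed

text \<open>The factor that the function \<open>f\<close> (with \<open>u I = |m_I f| * |<b,h_I>|\<close>), or \<open>g\<close> (with
\<open>u J = |<g,h_J>|\<close>), contributes at \<open>L\<close> once the coefficients are replaced by their bound
\<open>sqrt (|I| |J|) / |L|\<close>.\<close>

definition scale_coef :: "nat \<Rightarrow> (real set \<Rightarrow> real) \<Rightarrow> real set \<Rightarrow> real" where
  "scale_coef n u L = (\<Sum>I\<in>dyadic_gen n L. sqrt (ilen I) * u I) / sqrt (ilen L)"

text \<open>The intervals \<open>I\<close> below \<open>L\<close> are divided into those outside every stopping interval (\<open>gd\<close>) and the others
(\<open>bd\<close>).  The first are handled by the Cauchy-Schwarz inequality and the hypothesis on square sums.  For
the others only the trivial bound by the integral of \<open>\<phi>\<close> is available, but they are covered by the stopping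
intervals \<open>Q\<close> inside \<open>L\<close> with \<open>ilen L \<le> 2 ^ n * ilen Q\<close> (\<open>st\<close>), and a given \<open>Q\<close> serves at most
\<open>n + 1\<close> intervals \<open>L\<close>.  The constant 8 in the hypotheses is the threshold 4 of the stopping rule,
doubled by passing from an interval to its parent; 64 is its square.\<close>

lemma scale_coef_square_sum:
  fixes u :: "real set \<Rightarrow> real" and \<phi> :: "real \<Rightarrow> real"
  assumes Q0: "Q0 \<in> dyadic"
    and E: "finite \<E>" "\<E> \<subseteq> dyadic_sub Q0" "disjoint \<E>"
    and L: "finite \<L>" "\<L> \<subseteq> dyadic_sub Q0" "\<And>L Q. L \<in> \<L> \<Longrightarrow> Q \<in> \<E> \<Longrightarrow> \<not> L \<subseteq> Q"
    and phi: "dyadic_integrable \<phi>" "\<And>x. 0 \<le> \<phi> x"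
    and u: "\<And>I. 0 \<le> u I" "\<And>I. I \<in> dyadic \<Longrightarrow> sqrt (ilen I) * u I \<le> \<kappa> * mass \<phi> I"
    and k: "0 \<le> \<kappa>" "0 \<le> a"
    and stop: "\<And>Q. Q \<in> \<E> \<Longrightarrow> mass \<phi> Q \<le> 8 * a * ilen Q"
    and good: "\<And>\<H>. finite \<H> \<Longrightarrow> \<H> \<subseteq> (\<Union>L\<in>\<L>. dyadic_gen n L) \<Longrightarrow>
        (\<And>I Q. I \<in> \<H> \<Longrightarrow> Q \<in> \<E> \<Longrightarrow> \<not> I \<subseteq> Q) \<Longrightarrow> (\<Sum>I\<in>\<H>. (u I)\<^sup>2) \<le> 64 * (\<kappa> * a)\<^sup>2 * ilen Q0"
  shows "(\<Sum>L\<in>\<L>. (scale_coef n u L)\<^sup>2) \<le> 256 * real (n + 1) * (\<kappa> * a)\<^sup>2 * ilen Q0"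
proof -
  define gd where "gd L = {I \<in> dyadic_gen n L. \<forall>Q\<in>\<E>. \<not> I \<subseteq> Q}" for L
  define bd where "bd L = dyadic_gen n L - gd L" for L
  define st where "st L = {Q \<in> \<E>. Q \<subseteq> L \<and> ilen L \<le> 2 ^ n * ilen Q}" for L
  have Ed: "\<E> \<subseteq> dyadic" and Ld: "\<L> \<subseteq> dyadic" using E L by (auto simp: dyadic_sub_def)
  have single: "(scale_coef n u L)\<^sup>2 \<le> 2 * (\<Sum>I\<in>gd L. (u I)\<^sup>2) + 128 * (\<kappa> * a)\<^sup>2 * (\<Sum>Q\<in>st L. ilen Q)"
    if LL: "L \<in> \<L>" for L
  proof -
    have Ly: "L \<in> dyadic" using LL Ld by auto
    have pos: "0 < ilen L" by (rule ilen_pos[OF Ly])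
    have fin: "finite (gd L)" "finite (bd L)" "finite (st L)"
      using Ly E(1) by (auto simp: gd_def bd_def st_def)
    have gdy: "dyadic_gen n L \<subseteq> dyadic" by (auto dest: dyadic_genD)
    have dis: "disjoint (gd L)" "disjoint (bd L)" "disjoint (st L)"
      using disjoint_dyadic_gen[of n L] E(3) by (auto simp: disjoint_def gd_def bd_def st_def)
    define g where "g = (\<Sum>I\<in>gd L. sqrt (ilen I) * u I)"
    define b where "b = (\<Sum>I\<in>bd L. sqrt (ilen I) * u I)"
    have split: "scale_coef n u L = (g + b) / sqrt (ilen L)"
      unfolding scale_coef_def g_def b_def bd_def
      by (subst sum.subset_diff[of "gd L"]) (use Ly in \<open>auto simp: gd_def\<close>)
    have "(\<Sum>I\<in>gd L. ilen I) \<le> (\<Sum>I\<in>{L}. ilen I)"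
      by (rule ilen_Union_mono) (use fin dis gdy Ly in \<open>auto simp: gd_def dest: dyadic_genD\<close>)
    then have gl: "(\<Sum>I\<in>gd L. (sqrt (ilen I))\<^sup>2) \<le> ilen L"
      using gdy ilen_pos by (simp add: gd_def less_imp_le subset_iff)
    have "g\<^sup>2 \<le> (\<Sum>I\<in>gd L. (sqrt (ilen I))\<^sup>2) * (\<Sum>I\<in>gd L. (u I)\<^sup>2)"
      unfolding g_def by (rule Cauchy_Schwarz_ineq_sum)
    also have "\<dots> \<le> ilen L * (\<Sum>I\<in>gd L. (u I)\<^sup>2)"
      by (intro mult_right_mono gl sum_nonneg) auto
    finally have g2: "g\<^sup>2 \<le> ilen L * (\<Sum>I\<in>gd L. (u I)\<^sup>2)" .
    \<comment> \<open>A stopping interval that contains some \<open>I\<close> meets \<open>L\<close> without containing it, hence lies inside \<open>L\<close>.\<close>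
    have cover: "\<Union>(bd L) \<subseteq> \<Union>(st L)"
    proof
      fix x assume "x \<in> \<Union>(bd L)"
      then obtain I Q where I: "x \<in> I" "I \<in> dyadic_gen n L" and Q: "Q \<in> \<E>" "I \<subseteq> Q"
        by (auto simp: bd_def gd_def)
      have Qy: "Q \<in> dyadic" using Q Ed by auto
      have "\<not> L \<subseteq> Q" using L(3) LL Q by auto
      moreover have "Q \<inter> L \<noteq> {}" using I Q dyadic_genD(2)[OF I(2)] by auto
      ultimately have "Q \<subset> L" using dyadic_psubset_if_meets Qy Ly by blast
      moreover have "ilen L \<le> 2 ^ n * ilen Q"
        using dyadic_ilen_mono[OF dyadic_genD(1)[OF I(2)] Qy Q(2)] dyadic_genD(3)[OF I(2)] by (simp add: field_simps)
      ultimately show "x \<in> \<Union>(st L)" using I Q by (auto simp: st_def)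
    qed
    have "b \<le> (\<Sum>I\<in>bd L. \<kappa> * mass \<phi> I)"
      unfolding b_def using gdy by (intro sum_mono u(2)) (auto simp: bd_def)
    also have "\<dots> = \<kappa> * (\<Sum>I\<in>bd L. mass \<phi> I)" by (simp add: sum_distrib_left)
    also have "\<dots> \<le> \<kappa> * (\<Sum>Q\<in>st L. mass \<phi> Q)"
      using fin dis gdy Ed cover phi
      by (intro mult_left_mono k mass_Union_mono) (auto simp: bd_def st_def)
    also have "\<dots> \<le> \<kappa> * (\<Sum>Q\<in>st L. 8 * a * ilen Q)"
      by (intro mult_left_mono k sum_mono stop) (auto simp: st_def)
    finally have b1: "b \<le> 8 * (\<kappa> * a) * (\<Sum>Q\<in>st L. ilen Q)"
      by (simp add: sum_distrib_left[symmetric] sum_distrib_right[symmetric] mult_ac)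
    have "0 \<le> b" unfolding b_def using u(1) ilen_pos gdy
      by (intro sum_nonneg mult_nonneg_nonneg) (auto simp: bd_def less_imp_le subset_iff)
    then have "b\<^sup>2 \<le> (8 * (\<kappa> * a) * (\<Sum>Q\<in>st L. ilen Q))\<^sup>2" using b1 by (intro power_mono)
    also have "\<dots> = 64 * (\<kappa> * a)\<^sup>2 * ((\<Sum>Q\<in>st L. ilen Q) * (\<Sum>Q\<in>st L. ilen Q))"
      by (simp add: power2_eq_square)
    also have "\<dots> \<le> 64 * (\<kappa> * a)\<^sup>2 * (ilen L * (\<Sum>Q\<in>st L. ilen Q))"
    proof -
      have "(\<Sum>Q\<in>st L. ilen Q) \<le> (\<Sum>I\<in>{L}. ilen I)"
        by (rule ilen_Union_mono) (use fin dis Ed Ly in \<open>auto simp: st_def\<close>)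
      then show ?thesis
        using Ed ilen_pos
        by (intro mult_left_mono mult_right_mono sum_nonneg) (auto simp: st_def less_imp_le subset_iff)
    qed
    finally have b2: "b\<^sup>2 \<le> 64 * (\<kappa> * a)\<^sup>2 * (ilen L * (\<Sum>Q\<in>st L. ilen Q))" .
    have "(scale_coef n u L)\<^sup>2 = (g + b)\<^sup>2 / ilen L"
      unfolding split using pos by (simp add: power_divide)
    also have "\<dots> \<le> (2 * g\<^sup>2 + 2 * b\<^sup>2) / ilen L"
      using pos sum_squares_ge_zero[of "g - b" 0]
      by (intro divide_right_mono) (auto simp: power2_eq_square algebra_simps)
    also have "\<dots> \<le> (2 * (ilen L * (\<Sum>I\<in>gd L. (u I)\<^sup>2)) + 2 * (64 * (\<kappa> * a)\<^sup>2 * (ilen L * (\<Sum>Q\<in>st L. ilen Q)))) / ilen L"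
      using g2 b2 pos by (intro divide_right_mono) auto
    also have "\<dots> = 2 * (\<Sum>I\<in>gd L. (u I)\<^sup>2) + 128 * (\<kappa> * a)\<^sup>2 * (\<Sum>Q\<in>st L. ilen Q)"
      using pos by (simp add: field_simps)
    finally show ?thesis .
  qed
  have G: "(\<Sum>L\<in>\<L>. \<Sum>I\<in>gd L. (u I)\<^sup>2) \<le> 64 * (\<kappa> * a)\<^sup>2 * ilen Q0"
  proof -
    have "(\<Sum>L\<in>\<L>. \<Sum>I\<in>gd L. (u I)\<^sup>2) = (\<Sum>I\<in>(\<Union>L\<in>\<L>. gd L). (u I)\<^sup>2)"
    proof (rule sum.UNION_disjoint[symmetric])
      show "\<forall>L\<in>\<L>. finite (gd L)" using Ld by (auto simp: gd_def)
      show "\<forall>L\<in>\<L>. \<forall>L'\<in>\<L>. L \<noteq> L' \<longrightarrow> gd L \<inter> gd L' = {}"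
      proof (intro ballI impI)
        fix L L' assume LL: "L \<in> \<L>" "L' \<in> \<L>" "L \<noteq> L'"
        { fix I assume I: "I \<in> dyadic_gen n L" "I \<in> dyadic_gen n L'"
          then obtain x where "x \<in> I" using dyadic_genD(1) dyadic_nonempty by blast
          moreover have "ilen L = ilen L'" using dyadic_genD(3)[OF I(1)] dyadic_genD(3)[OF I(2)] by simp
          ultimately have "L = L'"
            using dyadic_eqI[of L L' x] LL Ld dyadic_genD(2)[OF I(1)] dyadic_genD(2)[OF I(2)] by auto }
        then show "gd L \<inter> gd L' = {}" using LL(3) by (auto simp: gd_def)
      qed
    qed (rule L)
    also have "\<dots> \<le> 64 * (\<kappa> * a)\<^sup>2 * ilen Q0"
      by (rule good) (use L(1) Ld in \<open>auto simp: gd_def\<close>)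
    finally show ?thesis .
  qed
  have S: "(\<Sum>L\<in>\<L>. \<Sum>Q\<in>st L. ilen Q) \<le> real (n + 1) * ilen Q0"
  proof -
    have "(\<Sum>L\<in>\<L>. \<Sum>Q\<in>st L. ilen Q) = (\<Sum>Q\<in>\<E>. \<Sum>L\<in>{L \<in> \<L>. Q \<subseteq> L \<and> ilen L \<le> 2 ^ n * ilen Q}. ilen Q)"
      unfolding st_def by (rule sum.swap_restrict) (use L E in auto)
    also have "\<dots> = (\<Sum>Q\<in>\<E>. real (card {L \<in> \<L>. Q \<subseteq> L \<and> ilen L \<le> 2 ^ n * ilen Q}) * ilen Q)" by simp
    also have "\<dots> \<le> (\<Sum>Q\<in>\<E>. real (n + 1) * ilen Q)"
    proof (intro sum_mono mult_right_mono)
      fix Q assume Q: "Q \<in> \<E>"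
      then have Qy: "Q \<in> dyadic" using Ed by auto
      have "card {L \<in> \<L>. Q \<subseteq> L \<and> ilen L \<le> 2 ^ n * ilen Q} \<le> n + 1"
        by (rule card_dyadic_ancestors(2)[OF Qy]) (use Ld in auto)
      then show "real (card {L \<in> \<L>. Q \<subseteq> L \<and> ilen L \<le> 2 ^ n * ilen Q}) \<le> real (n + 1)" by linarith
      show "0 \<le> ilen Q" using ilen_pos[OF Qy] by simp
    qed
    also have "\<dots> = real (n + 1) * (\<Sum>Q\<in>\<E>. ilen Q)" by (simp add: sum_distrib_left)
    also have "\<dots> \<le> real (n + 1) * (\<Sum>Q\<in>{Q0}. ilen Q)"
      by (intro mult_left_mono ilen_Union_mono) (use E Ed Q0 in \<open>auto simp: dyadic_sub_def\<close>)
    finally show ?thesis by simp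
  qed
  have "(\<Sum>L\<in>\<L>. (scale_coef n u L)\<^sup>2) \<le>
      (\<Sum>L\<in>\<L>. 2 * (\<Sum>I\<in>gd L. (u I)\<^sup>2) + 128 * (\<kappa> * a)\<^sup>2 * (\<Sum>Q\<in>st L. ilen Q))"
    by (intro sum_mono single)
  also have "\<dots> = 2 * (\<Sum>L\<in>\<L>. \<Sum>I\<in>gd L. (u I)\<^sup>2) + 128 * (\<kappa> * a)\<^sup>2 * (\<Sum>L\<in>\<L>. \<Sum>Q\<in>st L. ilen Q)"
    by (simp add: sum.distrib sum_distrib_left)
  also have "\<dots> \<le> 2 * (64 * (\<kappa> * a)\<^sup>2 * ilen Q0) + 128 * (\<kappa> * a)\<^sup>2 * (real (n + 1) * ilen Q0)"
    by (intro add_mono mult_left_mono G S) auto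
  also have "\<dots> \<le> 256 * real (n + 1) * (\<kappa> * a)\<^sup>2 * ilen Q0"
  proof -
    have "0 \<le> (\<kappa> * a)\<^sup>2 * ilen Q0" using ilen_pos[OF Q0] by simp
    then have "0 \<le> real n * ((\<kappa> * a)\<^sup>2 * ilen Q0)" by simp
    then show ?thesis by (simp add: algebra_simps)
  qed
  finally show ?thesis .
qed

lemma pairing_haar:
  assumes "J \<in> dyadic" "dyadic_integrable g"
  shows "pairing g (haar J) = (mass g (right_half J) - mass g (left_half J)) / of_real (sqrt (ilen J))"
proof -
  have i: "set_integrable lebesgue (right_half J) g" "set_integrable lebesgue (left_half J) g"
    using half_dyadic[OF assms(1)] dyadic_integrableD[OF assms(2)] by auto
  have "g x * cnj (haar J x) =
    (indicator (right_half J) x *\<^sub>R g x - indicator (left_half J) x *\<^sub>R g x) / of_real (sqrt (ilen J))" for x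
    by (auto simp: haar_def field_simps split: split_indicator)
  then show ?thesis
    using i unfolding pairing_def set_lebesgue_integral_def set_integrable_def by simp
qed

lemma cmod_diff_square: "(cmod (r - l))\<^sup>2 = 2 * (cmod r)\<^sup>2 + 2 * (cmod l)\<^sup>2 - (cmod (r + l))\<^sup>2"
  unfolding cmod_power2 by (simp add: power2_eq_square algebra_simps)

lemma mass_halves:
  assumes "J \<in> dyadic" "dyadic_integrable g"
  shows "mass g J = mass g (right_half J) + mass g (left_half J)"
proof -
  have "mass g (right_half J \<union> left_half J) = mass g (right_half J) + mass g (left_half J)"
    using half_dyadic[OF assms(1)] dyadic_integrableD[OF assms(2)] dyadic_gen_1(2)[OF assms(1)]
    by (intro set_integral_Un) auto
  then show ?thesis using dyadic_gen_1(3)[OF assms(1)] by (simp add: Un_commute)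
qed

text \<open>By the parallelogram law the Haar coefficient measures the increase of the energy
\<open>|integral of g over J|^2 / |J|\<close> when \<open>J\<close> is split into its halves.\<close>

lemma pairing_haar_square:
  assumes "J \<in> dyadic" "dyadic_integrable g"
  shows "(cmod (pairing g (haar J)))\<^sup>2 =
    (cmod (mass g (left_half J)))\<^sup>2 / ilen (left_half J) + (cmod (mass g (right_half J)))\<^sup>2 / ilen (right_half J)
      - (cmod (mass g J))\<^sup>2 / ilen J"
  using ilen_pos[OF assms(1)]
  unfolding pairing_haar[OF assms] mass_halves[OF assms] half_dyadic(5,6)[OF assms(1)]
  by (simp add: norm_divide power_divide cmod_diff_square) (simp add: field_simps)

text \<open>A Bessel inequality for a function whose averages are at most \<open>c\<close> until stopping: the sum telescopes by
\<open>pairing_haar_square\<close>, and what remains at the bottom is bounded by \<open>c^2\<close> times the total length.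
The family \<open>\<G>\<close> of intervals that are not stopped is closed under passing to larger intervals, so that the
sum over a stopped interval is empty.\<close>

lemma haar_square_sum_stopped:
  fixes g :: "real \<Rightarrow> complex"
  assumes Q0: "Q0 \<in> dyadic" and g: "dyadic_integrable g"
    and H: "finite \<H>" "\<H> \<subseteq> \<G>" "\<G> \<subseteq> dyadic_sub Q0"
    and up: "\<And>J J'. J \<in> \<G> \<Longrightarrow> J' \<in> dyadic_sub Q0 \<Longrightarrow> J \<subseteq> J' \<Longrightarrow> J' \<in> \<G>"
    and top: "cmod (mass g Q0) \<le> c * ilen Q0"
    and child: "\<And>J J'. J \<in> \<G> \<Longrightarrow> J' \<in> dyadic_gen 1 J \<Longrightarrow> cmod (mass g J') \<le> c * ilen J'"
  shows "(\<Sum>J\<in>\<H>. (cmod (pairing g (haar J)))\<^sup>2) \<le> c\<^sup>2 * ilen Q0"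
proof -
  have Hd: "\<H> \<subseteq> dyadic" using H by (auto simp: dyadic_sub_def)
  obtain \<delta> where d: "0 < \<delta>" "\<And>J. J \<in> \<H> \<Longrightarrow> \<delta> \<le> ilen J"
  proof (cases "\<H> = {}")
    case True then show thesis using that[of 1] by auto
  next
    case False
    show thesis
      by (rule that[of "Min (ilen ` \<H>)"]) (use False H(1) Hd ilen_pos in \<open>auto simp: subset_iff\<close>)
  qed
  have main: "(\<Sum>J\<in>{J \<in> \<H>. J \<subseteq> Q}. (cmod (pairing g (haar J)))\<^sup>2) \<le> c\<^sup>2 * ilen Q - (cmod (mass g Q))\<^sup>2 / ilen Q"
    if "Q \<in> dyadic_sub Q0" "cmod (mass g Q) \<le> c * ilen Q" "ilen Q < \<delta> * 2 ^ n" for Q n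
    using that
  proof (induction n arbitrary: Q)
    case (0 Q)
    have Qy: "Q \<in> dyadic" using 0 by (simp add: dyadic_sub_def)
    have e: "{J \<in> \<H>. J \<subseteq> Q} = {}"
      using 0(3) d(2) dyadic_ilen_mono[of _ Q] Qy Hd by force
    have "(cmod (mass g Q))\<^sup>2 \<le> (c * ilen Q)\<^sup>2" using 0(2) by (intro power_mono) auto
    then show ?case using ilen_pos[OF Qy] unfolding e by (simp add: field_simps power2_eq_square)
  next
    case (Suc n Q)
    have Qy: "Q \<in> dyadic" using Suc by (simp add: dyadic_sub_def)
    note hd = half_dyadic[OF Qy]
    let ?v = "\<lambda>J. (cmod (pairing g (haar J)))\<^sup>2"
    have sq: "(cmod (mass g Q))\<^sup>2 \<le> (c * ilen Q)\<^sup>2" using Suc(3) by (intro power_mono) auto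
    show ?case
    proof (cases "Q \<in> \<G>")
      case False
      then have e: "{J \<in> \<H>. J \<subseteq> Q} = {}" using up[of _ Q] H(2) Suc(2) by blast
      show ?thesis using ilen_pos[OF Qy] sq unfolding e by (simp add: field_simps power2_eq_square)
    next
      case True
      have cl: "cmod (mass g R) \<le> c * ilen R" if "R = left_half Q \<or> R = right_half Q" for R
        using child[OF True, of R] dyadic_gen_1(1)[OF Qy] that by auto
      have IH: "(\<Sum>J\<in>{J \<in> \<H>. J \<subseteq> R}. ?v J) \<le> c\<^sup>2 * ilen R - (cmod (mass g R))\<^sup>2 / ilen R"
        if "R = left_half Q \<or> R = right_half Q" for R
      proof (rule Suc.IH)
        show "R \<in> dyadic_sub Q0" using that hd Suc(2) by (auto simp: dyadic_sub_def)
        show "cmod (mass g R) \<le> c * ilen R" by (rule cl[OF that])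
        show "ilen R < \<delta> * 2 ^ n" using that hd(5,6) Suc(4) by auto
      qed
      have "(\<Sum>J\<in>{J \<in> \<H>. J \<subseteq> Q}. ?v J) \<le>
          (\<Sum>J\<in>insert Q ({J \<in> \<H>. J \<subseteq> left_half Q} \<union> {J \<in> \<H>. J \<subseteq> right_half Q}). ?v J)"
        using dyadic_psubset_half[OF Qy] Hd H(1) by (intro sum_mono2) auto
      also have "\<dots> \<le> ?v Q + (\<Sum>J\<in>{J \<in> \<H>. J \<subseteq> left_half Q} \<union> {J \<in> \<H>. J \<subseteq> right_half Q}. ?v J)"
        using H(1) by (subst sum.insert_if) auto
      also have "\<dots> \<le> ?v Q + ((\<Sum>J\<in>{J \<in> \<H>. J \<subseteq> left_half Q}. ?v J) + (\<Sum>J\<in>{J \<in> \<H>. J \<subseteq> right_half Q}. ?v J))"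
        using H(1) by (intro add_left_mono) (auto simp: sum_Un sum_nonneg)
      also have "\<dots> \<le> c\<^sup>2 * ilen Q - (cmod (mass g Q))\<^sup>2 / ilen Q"
      proof -
        have "c\<^sup>2 * ilen (left_half Q) + c\<^sup>2 * ilen (right_half Q) = c\<^sup>2 * ilen Q"
          unfolding hd(5,6) by simp
        then show ?thesis
          using IH[OF disjI1[OF refl]] IH[OF disjI2[OF refl]]
          unfolding pairing_haar_square[OF Qy g] by linarith
      qed
      finally show ?thesis .
    qed
  qed
  obtain n where "ilen Q0 / \<delta> < 2 ^ n" using real_arch_pow[of 2] by force
  then have "ilen Q0 < \<delta> * 2 ^ n" using d(1) by (simp add: field_simps)
  from main[OF _ top this] have
    "(\<Sum>J\<in>{J \<in> \<H>. J \<subseteq> Q0}. (cmod (pairing g (haar J)))\<^sup>2) \<le> c\<^sup>2 * ilen Q0 - (cmod (mass g Q0))\<^sup>2 / ilen Q0"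
    using Q0 by (simp add: dyadic_sub_def)
  also have "\<dots> \<le> c\<^sup>2 * ilen Q0" using ilen_pos[OF Q0] by simp
  also have "{J \<in> \<H>. J \<subseteq> Q0} = \<H>" using H by (auto simp: dyadic_sub_def)
  finally show ?thesis .
qed

section \<open>Stopping families and the energy induction\<close>

text \<open>The weak type inequality behind the stopping rule: where the average of \<open>\<phi>\<close> exceeds four times its
average over \<open>Q0\<close>, the total length is at most a quarter.\<close>

lemma stopping_size:
  assumes Q0: "Q0 \<in> dyadic" and phi: "dyadic_integrable \<phi>" "\<And>x. (0 :: real) \<le> \<phi> x"
    and E: "finite \<E>" "\<E> \<subseteq> dyadic_sub Q0" "disjoint \<E>"
    and big: "\<And>Q. Q \<in> \<E> \<Longrightarrow> 4 * mass \<phi> Q0 * ilen Q < mass \<phi> Q * ilen Q0"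
  shows "4 * (\<Sum>Q\<in>\<E>. ilen Q) \<le> ilen Q0"
proof -
  have Ed: "\<E> \<subseteq> dyadic" using E by (auto simp: dyadic_sub_def)
  have mono: "(\<Sum>Q\<in>\<E>. mass \<phi> Q) \<le> (\<Sum>Q\<in>{Q0}. mass \<phi> Q)"
    by (rule mass_Union_mono) (use E Ed Q0 phi in \<open>auto simp: dyadic_sub_def\<close>)
  have nn: "0 \<le> mass \<phi> Q" for Q by (rule mass_nonneg) (rule phi)
  have l: "0 < ilen Q0" by (rule ilen_pos[OF Q0])
  show ?thesis
  proof (cases "mass \<phi> Q0 = 0")
    case True
    have "\<E> = {}"
    proof (rule ccontr)
      assume "\<E> \<noteq> {}"
      then obtain Q where Q: "Q \<in> \<E>" by auto
      have "mass \<phi> Q \<le> (\<Sum>Q\<in>\<E>. mass \<phi> Q)" by (rule member_le_sum[OF Q]) (use nn E in auto)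
      then have "mass \<phi> Q = 0" using mono True nn[of Q] by simp
      then show False using big[OF Q] True by simp
    qed
    then show ?thesis using l by simp
  next
    case False
    then have pos: "0 < mass \<phi> Q0" using nn[of Q0] by simp
    have "mass \<phi> Q0 * (4 * (\<Sum>Q\<in>\<E>. ilen Q)) = (\<Sum>Q\<in>\<E>. 4 * mass \<phi> Q0 * ilen Q)"
      unfolding sum_distrib_left[symmetric] by simp
    also have "\<dots> \<le> (\<Sum>Q\<in>\<E>. mass \<phi> Q * ilen Q0)" by (intro sum_mono less_imp_le big)
    also have "\<dots> = (\<Sum>Q\<in>\<E>. mass \<phi> Q) * ilen Q0" by (simp add: sum_distrib_right)
    also have "\<dots> \<le> mass \<phi> Q0 * ilen Q0" using mono l by (intro mult_right_mono) auto
    finally show ?thesis using pos by simp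
  qed
qed

text \<open>Two rules, each of which removes at most a quarter of \<open>Q0\<close>, leave at least half of it.  Averages over a
stopping interval are at most twice those over its parent, to which the rule did not apply.\<close>

lemma stopping_family:
  assumes Q0: "Q0 \<in> dyadic" and d: "0 < \<delta>"
    and phi: "dyadic_integrable \<phi>" "\<And>x. (0 :: real) \<le> \<phi> x"
    and psi: "dyadic_integrable \<psi>" "\<And>x. (0 :: real) \<le> \<psi> x"
  obtains \<E> where "finite \<E>" "\<E> \<subseteq> dyadic_sub Q0" "disjoint \<E>" "Q0 \<notin> \<E>"
    "2 * (\<Sum>Q\<in>\<E>. ilen Q) \<le> ilen Q0"
    "\<And>J. J \<in> dyadic_sub Q0 \<Longrightarrow> \<delta> \<le> ilen J \<Longrightarrow> (\<And>Q. Q \<in> \<E> \<Longrightarrow> \<not> J \<subseteq> Q) \<Longrightarrow>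
      mass \<phi> J \<le> 4 * (mass \<phi> Q0 / ilen Q0) * ilen J \<and> mass \<psi> J \<le> 4 * (mass \<psi> Q0 / ilen Q0) * ilen J"
    "\<And>Q. Q \<in> \<E> \<Longrightarrow> mass \<phi> Q \<le> 8 * (mass \<phi> Q0 / ilen Q0) * ilen Q \<and> mass \<psi> Q \<le> 8 * (mass \<psi> Q0 / ilen Q0) * ilen Q"
proof -
  define big where "big \<theta> Q \<longleftrightarrow> 4 * mass \<theta> Q0 * ilen Q < mass \<theta> Q * ilen Q0" for \<theta> :: "real \<Rightarrow> real" and Q
  define \<B> where "\<B> = {Q \<in> dyadic_sub Q0. \<delta> \<le> ilen Q \<and> (big \<phi> Q \<or> big \<psi> Q)}"
  have l: "0 < ilen Q0" by (rule ilen_pos[OF Q0])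
  have nn: "0 \<le> mass \<phi> Q" "0 \<le> mass \<psi> Q" for Q
    using phi psi by (auto intro: mass_nonneg)
  have finB: "finite \<B>"
    by (rule finite_subset[OF _ finite_dyadic_sub_ge[OF Q0 d]]) (auto simp: \<B>_def)
  have Bd: "\<B> \<subseteq> dyadic" by (auto simp: \<B>_def dyadic_sub_def)
  have top: "Q0 \<notin> \<B>"
    using nn(1)[of Q0] nn(2)[of Q0] l mult_nonneg_nonneg[of "mass \<phi> Q0" "ilen Q0"]
      mult_nonneg_nonneg[of "mass \<psi> Q0" "ilen Q0"] by (auto simp: \<B>_def big_def mult.commute)
  obtain \<E> where E: "\<E> \<subseteq> \<B>" "disjoint \<E>" "\<And>L. L \<in> \<B> \<Longrightarrow> \<exists>Q\<in>\<E>. L \<subseteq> Q"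
    using dyadic_maximal_elements[OF finB Bd] by metis
  have finE: "finite \<E>" using E(1) finB finite_subset by blast
  have Esub: "\<E> \<subseteq> dyadic_sub Q0" using E(1) by (auto simp: \<B>_def)
  have Ed: "\<E> \<subseteq> dyadic" using E(1) Bd by auto
  have avg: "mass \<phi> J \<le> 4 * (mass \<phi> Q0 / ilen Q0) * ilen J \<and> mass \<psi> J \<le> 4 * (mass \<psi> Q0 / ilen Q0) * ilen J"
    if "J \<in> dyadic_sub Q0" "\<delta> \<le> ilen J" "\<And>Q. Q \<in> \<E> \<Longrightarrow> \<not> J \<subseteq> Q" for J
  proof -
    have "J \<notin> \<B>" using E(3) that(3) by auto
    then have "\<not> big \<phi> J" "\<not> big \<psi> J" using that by (auto simp: \<B>_def)
    then show ?thesis using l by (simp add: big_def field_simps)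
  qed
  have stop: "mass \<phi> Q \<le> 8 * (mass \<phi> Q0 / ilen Q0) * ilen Q \<and> mass \<psi> Q \<le> 8 * (mass \<psi> Q0 / ilen Q0) * ilen Q"
    if Q: "Q \<in> \<E>" for Q
  proof -
    have Qy: "Q \<in> dyadic" using Q Ed by auto
    obtain P where P: "P \<in> dyadic" "Q \<in> dyadic_gen 1 P" using dyadic_parent[OF Qy] .
    have QP: "Q \<subseteq> P" "ilen Q = ilen P / 2" using dyadic_genD[OF P(2)] by auto
    obtain x where x: "x \<in> Q" using dyadic_nonempty[OF Qy] by auto
    have QQ: "Q \<subseteq> Q0" "Q \<noteq> Q0" using Q Esub top E(1) by (auto simp: dyadic_sub_def)
    have "ilen P \<le> ilen Q0"
    proof -
      obtain n where n: "Q \<in> dyadic_gen n Q0" using dyadic_sub_gen[OF Qy Q0 QQ(1)] .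
      have e: "ilen Q = ilen Q0 / 2 ^ n" using dyadic_genD(3)[OF n] .
      have "n \<noteq> 0"
        using e dyadic_eqI[OF Qy Q0 x] QQ x by (metis div_by_1 power_0 subsetD)
      then have "(2::real) \<le> 2 ^ n" by (cases n) simp_all
      then have "ilen Q0 / 2 ^ n \<le> ilen Q0 / 2" using l by (intro divide_left_mono) auto
      then show ?thesis using e QP(2) by simp
    qed
    then have PQ0: "P \<subseteq> Q0" using dyadic_nested[OF P(1) Q0, of x] QP QQ x by auto
    have "\<not> P \<subseteq> R" if R: "R \<in> \<E>" for R
    proof
      assume PR: "P \<subseteq> R"
      have "R \<inter> Q \<noteq> {}" using PR QP x by auto
      then have "R = Q" using E(2) R Q by (auto simp: disjoint_def)
      then have "P = Q" using PR QP by auto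
      then show False using QP ilen_pos[OF Qy] by simp
    qed
    moreover have "\<delta> \<le> ilen P" using Q E(1) QP(2) ilen_pos[OF Qy] by (auto simp: \<B>_def)
    ultimately have "mass \<phi> P \<le> 4 * (mass \<phi> Q0 / ilen Q0) * ilen P \<and> mass \<psi> P \<le> 4 * (mass \<psi> Q0 / ilen Q0) * ilen P"
      using avg[of P] P(1) PQ0 by (auto simp: dyadic_sub_def)
    moreover have "mass \<phi> Q \<le> mass \<phi> P" "mass \<psi> Q \<le> mass \<psi> P"
      using mass_subset_mono[OF dyadic_integrableD[OF phi(1) P(1)] _ QP(1)]
        mass_subset_mono[OF dyadic_integrableD[OF psi(1) P(1)] _ QP(1)] Qy phi psi by auto
    moreover have "ilen P = 2 * ilen Q" using QP(2) by simp
    ultimately show ?thesis by (auto simp: algebra_simps)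
  qed
  have size: "2 * (\<Sum>Q\<in>\<E>. ilen Q) \<le> ilen Q0"
  proof -
    have sub: "4 * (\<Sum>Q\<in>{Q \<in> \<E>. big \<theta> Q}. ilen Q) \<le> ilen Q0"
      if "dyadic_integrable \<theta>" "\<And>x. 0 \<le> \<theta> x" for \<theta>
      by (rule stopping_size[OF Q0 that])
        (use finE Esub E(2) in \<open>auto simp: big_def disjoint_def\<close>)
    have "(\<Sum>Q\<in>\<E>. ilen Q) = (\<Sum>Q\<in>{Q \<in> \<E>. big \<phi> Q} \<union> {Q \<in> \<E>. big \<psi> Q}. ilen Q)"
      using E(1) by (intro sum.cong) (auto simp: \<B>_def)
    also have "\<dots> \<le> (\<Sum>Q\<in>{Q \<in> \<E>. big \<phi> Q}. ilen Q) + (\<Sum>Q\<in>{Q \<in> \<E>. big \<psi> Q}. ilen Q)"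
      using finE sum_nonneg[of "{Q \<in> \<E>. big \<phi> Q} \<inter> {Q \<in> \<E>. big \<psi> Q}" ilen] Ed ilen_pos
      by (auto simp: sum_Un less_imp_le subset_iff)
    finally show ?thesis using sub[OF phi] sub[OF psi] by simp
  qed
  show thesis by (rule that[OF finE Esub E(2) _ size avg stop]) (use top E(1) in auto)
qed

text \<open>Superadditivity of \<open>P - F^2 / (2 \<mu>)\<close> with a gain.  The index set \<open>M\<close> stands for the stopping intervals and
\<open>E\<close> for the remaining part of \<open>Q0\<close>.  The hypothesis on \<open>PE\<close> is the Cauchy-Schwarz inequality
\<open>FE^2 \<le> PE * \<mu>E\<close> in linear form.  The denominator \<open>2 \<mu>\<close> instead of \<open>\<mu>\<close> is what makes room for the gain:
on \<open>E\<close> the energy \<open>PE\<close> is at least \<open>FE^2 / \<mu>E\<close>, twice what superadditivity alone requires.\<close>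

lemma energy_step:
  fixes F \<mu> P :: "'i \<Rightarrow> real"
  assumes F: "F0 = FE + (\<Sum>i\<in>M. F i)" and mu: "\<mu>0 = \<mu>E + (\<Sum>i\<in>M. \<mu> i)" and P: "P0 = PE + (\<Sum>i\<in>M. P i)"
    and pos: "0 < \<mu>0" "\<And>i. i \<in> M \<Longrightarrow> 0 < \<mu> i"
    and PE: "\<And>t. 2 * t * FE - t\<^sup>2 * \<mu>E \<le> PE"
  shows "(F0 / \<mu>0)\<^sup>2 * \<mu>E / 4 \<le> (P0 - F0\<^sup>2 / (2 * \<mu>0)) - (\<Sum>i\<in>M. P i - (F i)\<^sup>2 / (2 * \<mu> i))"
proof -
  \<comment> \<open>Each \<open>F^2 / (2 \<mu>)\<close> is bounded below by its tangent line at \<open>F = 2 t \<mu>\<close>, the ratio found on \<open>Q0\<close> as a whole.\<close>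
  define t where "t = F0 / (2 * \<mu>0)"
  have F0: "F0 = 2 * t * \<mu>0" using pos(1) by (simp add: t_def)
  have tm: "2 * t * F i - 2 * t\<^sup>2 * \<mu> i \<le> (F i)\<^sup>2 / (2 * \<mu> i)" if "i \<in> M" for i
  proof -
    have "0 \<le> (F i - 2 * t * \<mu> i)\<^sup>2" by simp
    then have "(2 * t * F i - 2 * t\<^sup>2 * \<mu> i) * (2 * \<mu> i) \<le> (F i)\<^sup>2"
      by (simp add: power2_eq_square algebra_simps)
    then show ?thesis using pos(2)[OF that] by (simp add: pos_le_divide_eq)
  qed
  have "2 * t * (\<Sum>i\<in>M. F i) - 2 * t\<^sup>2 * (\<Sum>i\<in>M. \<mu> i) = (\<Sum>i\<in>M. 2 * t * F i - 2 * t\<^sup>2 * \<mu> i)"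
    by (simp add: sum_subtractf sum_distrib_left)
  also have "\<dots> \<le> (\<Sum>i\<in>M. (F i)\<^sup>2 / (2 * \<mu> i))" by (intro sum_mono tm)
  finally have S: "2 * t * (F0 - FE) - 2 * t\<^sup>2 * (\<mu>0 - \<mu>E) \<le> (\<Sum>i\<in>M. (F i)\<^sup>2 / (2 * \<mu> i))"
    unfolding F mu by simp
  have "F0\<^sup>2 / (2 * \<mu>0) = 2 * t\<^sup>2 * \<mu>0" "(F0 / \<mu>0)\<^sup>2 * \<mu>E / 4 = t\<^sup>2 * \<mu>E" "t * F0 = 2 * t\<^sup>2 * \<mu>0"
    using pos(1) unfolding F0 by (simp_all add: power2_eq_square field_simps)
  moreover have "2 * t * (F0 - FE) = 2 * (t * F0) - 2 * t * FE"
    "2 * t\<^sup>2 * (\<mu>0 - \<mu>E) = 2 * t\<^sup>2 * \<mu>0 - 2 * (t\<^sup>2 * \<mu>E)"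
    by (simp_all add: algebra_simps)
  ultimately show ?thesis
    using S PE[of t] unfolding sum_subtractf P by linarith
qed

lemma mass_pos:
  assumes "I \<in> dyadic" "dyadic_integrable u" "AE x in lebesgue. (0 :: real) < u x"
  shows "0 < mass u I"
proof -
  have i: "integrable lebesgue (\<lambda>x. indicator I x *\<^sub>R u x)"
    using dyadic_integrableD[OF assms(2,1)] by (simp add: set_integrable_def)
  have nn: "AE x in lebesgue. 0 \<le> indicator I x *\<^sub>R u x"
    using assms(3) by eventually_elim (auto split: split_indicator)
  have "mass u I \<noteq> 0"
  proof
    assume "mass u I = 0"
    then have "AE x in lebesgue. indicator I x *\<^sub>R u x = 0"
      using integral_nonneg_eq_0_iff_AE[OF i nn] by (simp add: set_lebesgue_integral_def)
    then have "AE x in lebesgue. x \<notin> I"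
      using assms(3) by eventually_elim (auto split: split_indicator)
    then have "emeasure lebesgue I = 0"
      using assms(1) by (subst (asm) AE_iff_measurable[of I]) auto
    then show False using dyadic_emeasure[OF assms(1)] ilen_pos[OF assms(1)] by simp
  qed
  moreover have "0 \<le> mass u I" unfolding set_lebesgue_integral_def by (rule integral_nonneg_AE[OF nn])
  ultimately show ?thesis by simp
qed

text \<open>Pointwise \<open>2 \<alpha> \<beta> \<le> s \<alpha>^2 / w + \<beta>^2 w / s\<close>, the inequality of arithmetic and geometric means, since the
product of the two terms on the right is \<open>(\<alpha> \<beta>)^2\<close>.\<close>

lemma weight_pair_bound:
  assumes E: "E \<in> sets lebesgue" "E \<subseteq> Q" "Q \<in> dyadic"
    and w: "dyadic_integrable w" "dyadic_integrable (\<lambda>x. inverse (w x))" "AE x in lebesgue. (0 :: real) < w x"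
    and s: "0 < s"
  shows "2 * \<alpha> * \<beta> * measure lebesgue E \<le> s * \<alpha>\<^sup>2 * mass (\<lambda>x. inverse (w x)) E + \<beta>\<^sup>2 / s * mass w E"
proof -
  have i: "set_integrable lebesgue E w" "set_integrable lebesgue E (\<lambda>x. inverse (w x))"
    "set_integrable lebesgue E (\<lambda>_. 1 :: real)"
    using set_integrable_subset[OF dyadic_integrableD[OF w(1) E(3)] E(1,2)]
      set_integrable_subset[OF dyadic_integrableD[OF w(2) E(3)] E(1,2)]
      set_integrable_subset[OF dyadic_integrableD[OF dyadic_integrable_one E(3)] E(1,2)] by auto
  have "2 * \<alpha> * \<beta> * measure lebesgue E = mass (\<lambda>_. 2 * \<alpha> * \<beta> * 1) E"
    using E(1) by (simp add: set_lebesgue_integral_def)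
  also have "\<dots> \<le> mass (\<lambda>x. s * \<alpha>\<^sup>2 * inverse (w x) + \<beta>\<^sup>2 / s * w x) E"
  proof (rule set_integral_mono_AE)
    show "set_integrable lebesgue E (\<lambda>_. 2 * \<alpha> * \<beta> * 1)" using i(3) by (rule set_integrable_mult_right)
    show "set_integrable lebesgue E (\<lambda>x. s * \<alpha>\<^sup>2 * inverse (w x) + \<beta>\<^sup>2 / s * w x)"
      using i by (intro set_integral_add set_integrable_mult_right) auto
    show "AE x\<in>E in lebesgue. 2 * \<alpha> * \<beta> * 1 \<le> s * \<alpha>\<^sup>2 * inverse (w x) + \<beta>\<^sup>2 / s * w x"
      using w(3)
    proof eventually_elim
      case (elim x)
      have "s * \<alpha>\<^sup>2 * inverse (w x) + \<beta>\<^sup>2 / s * w x - 2 * \<alpha> * \<beta> = (s * \<alpha> - \<beta> * w x)\<^sup>2 / (s * w x)"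
        using elim s by (simp add: field_simps power2_eq_square)
      also have "\<dots> \<ge> 0" using elim s by simp
      finally show ?case by simp
    qed
  qed
  also have "\<dots> = s * \<alpha>\<^sup>2 * mass (\<lambda>x. inverse (w x)) E + \<beta>\<^sup>2 / s * mass w E"
    using i by (subst set_integral_add) auto
  finally show ?thesis .
qed

lemma mass_energy_bound:
  assumes E: "E \<in> sets lebesgue" "E \<subseteq> Q" "Q \<in> dyadic"
    and i: "dyadic_integrable \<phi>" "dyadic_integrable \<mu>" "dyadic_integrable p"
    and ae: "AE x in lebesgue. 2 * t * \<phi> x - t\<^sup>2 * \<mu> x \<le> (p x :: real)"
  shows "2 * t * mass \<phi> E - t\<^sup>2 * mass \<mu> E \<le> mass p E"
proof -
  have i: "set_integrable lebesgue E \<phi>" "set_integrable lebesgue E \<mu>" "set_integrable lebesgue E p"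
    using set_integrable_subset[OF dyadic_integrableD[OF i(1) E(3)] E(1,2)]
      set_integrable_subset[OF dyadic_integrableD[OF i(2) E(3)] E(1,2)]
      set_integrable_subset[OF dyadic_integrableD[OF i(3) E(3)] E(1,2)] by auto
  have "2 * t * mass \<phi> E - t\<^sup>2 * mass \<mu> E = mass (\<lambda>x. 2 * t * \<phi> x - t\<^sup>2 * \<mu> x) E"
    using i by (subst set_integral_diff) (auto intro: set_integrable_mult_right)
  also have "\<dots> \<le> mass p E"
    using i ae by (intro set_integral_mono_AE set_integral_diff set_integrable_mult_right) (auto elim: AE_mp)
  finally show ?thesis .
qed

text \<open>\<open>B Q = s * U Q + V Q / s\<close> serves as a Bellman function.  The intervals \<open>L\<close> inside \<open>Q\<close> that no stopping interval
contains cost \<open>K * F(Q) G(Q) / |Q|\<close>, which is at most \<open>4 K A\<close> times the excess of \<open>B Q\<close> over the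
sum of \<open>B\<close> over the stopping intervals; the latter pays for the other \<open>L\<close> by induction.  The induction runs over
the number of generations between \<open>Q\<close> and the smallest member of \<open>\<L>\<close>.  The parameter \<open>s\<close> is free so that
the sum of two energies on the right can be turned into a product of norms.\<close>

lemma bellman_induction:
  fixes w \<phi> \<psi> :: "real \<Rightarrow> real" and T :: "real set \<Rightarrow> real"
  defines "\<sigma> \<equiv> \<lambda>x. inverse (w x)"
  assumes w: "dyadic_integrable w" "dyadic_integrable \<sigma>" "AE x in lebesgue. 0 < w x"
    and A: "\<And>I. I \<in> dyadic \<Longrightarrow> mass w I * mass \<sigma> I \<le> A * (ilen I)\<^sup>2"
    and phi: "dyadic_integrable \<phi>" "\<And>x. 0 \<le> \<phi> x" "dyadic_integrable (\<lambda>x. (\<phi> x)\<^sup>2 * w x)"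
    and psi: "dyadic_integrable \<psi>" "\<And>x. 0 \<le> \<psi> x" "dyadic_integrable (\<lambda>x. (\<psi> x)\<^sup>2 * \<sigma> x)"
    and L: "finite \<L>" "\<L> \<subseteq> dyadic"
    and K: "0 \<le> K" and s: "0 < s"
    and stop: "\<And>Q0. Q0 \<in> dyadic \<Longrightarrow> \<exists>\<E>. finite \<E> \<and> \<E> \<subseteq> dyadic_sub Q0 \<and> disjoint \<E> \<and> Q0 \<notin> \<E> \<and>
        2 * (\<Sum>Q\<in>\<E>. ilen Q) \<le> ilen Q0 \<and>
        (\<Sum>L\<in>{L \<in> \<L>. L \<subseteq> Q0 \<and> (\<forall>Q\<in>\<E>. \<not> L \<subseteq> Q)}. T L) \<le> K * (mass \<phi> Q0 * mass \<psi> Q0 / ilen Q0)"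
    and Q0: "Q0 \<in> dyadic"
  shows "(\<Sum>L\<in>{L \<in> \<L>. L \<subseteq> Q0}. T L) \<le>
    4 * K * A * (s * mass (\<lambda>x. (\<phi> x)\<^sup>2 * w x) Q0 + mass (\<lambda>x. (\<psi> x)\<^sup>2 * \<sigma> x) Q0 / s)"
proof -
  let ?p = "\<lambda>x. (\<phi> x)\<^sup>2 * w x" and ?q = "\<lambda>x. (\<psi> x)\<^sup>2 * \<sigma> x"
  define U where "U Q = mass ?p Q - (mass \<phi> Q)\<^sup>2 / (2 * mass \<sigma> Q)" for Q
  define V where "V Q = mass ?q Q - (mass \<psi> Q)\<^sup>2 / (2 * mass w Q)" for Q
  have s_ae: "AE x in lebesgue. 0 < \<sigma> x" using w(3) by eventually_elim (simp add: \<sigma>_def)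
  have wpos: "0 < mass w Q" and spos: "0 < mass \<sigma> Q" if "Q \<in> dyadic" for Q
    using mass_pos[OF that w(1,3)] mass_pos[OF that w(2) s_ae] by auto
  have A0: "0 < A"
  proof -
    have "0 < A * (ilen Q0)\<^sup>2" using A[OF Q0] wpos[OF Q0] spos[OF Q0] by (smt (verit) mult_pos_pos)
    then show ?thesis using ilen_pos[OF Q0] by (simp add: zero_less_mult_iff)
  qed
  have aep: "AE x in lebesgue. 2 * t * \<phi> x - t\<^sup>2 * \<sigma> x \<le> ?p x" for t
    using w(3)
  proof eventually_elim
    case (elim x)
    have "?p x - (2 * t * \<phi> x - t\<^sup>2 * \<sigma> x) = (\<phi> x * w x - t)\<^sup>2 / w x"
      using elim by (simp add: \<sigma>_def field_simps power2_eq_square)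
    also have "\<dots> \<ge> 0" using elim by simp
    finally show ?case by simp
  qed
  have aeq: "AE x in lebesgue. 2 * t * \<psi> x - t\<^sup>2 * w x \<le> ?q x" for t
    using w(3)
  proof eventually_elim
    case (elim x)
    have "?q x - (2 * t * \<psi> x - t\<^sup>2 * w x) = (\<psi> x - t * w x)\<^sup>2 / w x"
      using elim by (simp add: \<sigma>_def field_simps power2_eq_square)
    also have "\<dots> \<ge> 0" using elim by simp
    finally show ?case by simp
  qed
  note bp = mass_energy_bound[OF _ _ _ phi(1) w(2) phi(3) aep]
  note bq = mass_energy_bound[OF _ _ _ psi(1) w(1) psi(3) aeq]
  have UV: "0 \<le> U Q" "0 \<le> V Q" "U Q \<le> mass ?p Q" "V Q \<le> mass ?q Q" if Q: "Q \<in> dyadic" for Q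
  proof -
    have gen: "F\<^sup>2 / (2 * m) \<le> P" if "0 < m" "\<And>t. 2 * t * F - t\<^sup>2 * m \<le> P" for F m P :: real
    proof -
      have "F\<^sup>2 / (2 * m) \<le> F\<^sup>2 / m" using that(1) by (intro divide_left_mono) auto
      also have "\<dots> = 2 * (F / m) * F - (F / m)\<^sup>2 * m" using that(1) by (simp add: field_simps power2_eq_square)
      also have "\<dots> \<le> P" by (rule that(2))
      finally show ?thesis .
    qed
    show "0 \<le> U Q" unfolding U_def using gen[OF spos[OF Q] bp[OF _ subset_refl Q]] Q by simp
    show "0 \<le> V Q" unfolding V_def using gen[OF wpos[OF Q] bq[OF _ subset_refl Q]] Q by simp
    show "U Q \<le> mass ?p Q" "V Q \<le> mass ?q Q"
      unfolding U_def V_def using spos[OF Q] wpos[OF Q] by simp_all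
  qed
  define B where "B Q = s * U Q + V Q / s" for Q
  have B0: "0 \<le> B Q" if "Q \<in> dyadic" for Q using UV[OF that] s by (simp add: B_def)
  obtain \<delta> where d: "0 < \<delta>" "\<And>J. J \<in> \<L> \<Longrightarrow> \<delta> \<le> ilen J"
  proof (cases "\<L> = {}")
    case True then show thesis using that[of 1] by auto
  next
    case False
    show thesis
      by (rule that[of "Min (ilen ` \<L>)"]) (use False L ilen_pos in \<open>auto simp: subset_iff\<close>)
  qed
  have main: "(\<Sum>L\<in>{L \<in> \<L>. L \<subseteq> Q}. T L) \<le> 4 * K * A * B Q" if "Q \<in> dyadic" "ilen Q < \<delta> * 2 ^ n" for Q n
    using that
  proof (induction n arbitrary: Q)
    case (0 Q)
    have e: "{L \<in> \<L>. L \<subseteq> Q} = {}"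
      using 0 d(2) dyadic_ilen_mono[of _ Q] L by force
    show ?case unfolding e using B0[OF 0(1)] K A0 by simp
  next
    case (Suc n Q)
    note Qy = Suc.prems(1)
    have lQ: "0 < ilen Q" by (rule ilen_pos[OF Qy])
    obtain \<E> where E: "finite \<E>" "\<E> \<subseteq> dyadic_sub Q" "disjoint \<E>" "Q \<notin> \<E>"
      "2 * (\<Sum>R\<in>\<E>. ilen R) \<le> ilen Q"
      and loc: "(\<Sum>L\<in>{L \<in> \<L>. L \<subseteq> Q \<and> (\<forall>R\<in>\<E>. \<not> L \<subseteq> R)}. T L) \<le> K * (mass \<phi> Q * mass \<psi> Q / ilen Q)"
      using stop[OF Qy] by blast
    have Ed: "\<E> \<subseteq> dyadic" and EQ: "\<Union>\<E> \<subseteq> Q" using E by (auto simp: dyadic_sub_def)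
    define D where "D = Q - \<Union>\<E>"
    have D: "D \<in> sets lebesgue" "D \<subseteq> Q"
      using mass_Union(3)[OF E(1) Ed E(3) phi(1)] Qy by (auto simp: D_def)
    note split = mass_split[OF E(1) Ed E(3) EQ Qy, folded D_def]
    have sizeD: "ilen Q \<le> 2 * measure lebesgue D"
    proof -
      have "ilen Q = measure lebesgue D + (\<Sum>R\<in>\<E>. ilen R)"
      proof -
        have "(\<Sum>R\<in>\<E>. mass (\<lambda>_. 1 :: real) R) = (\<Sum>R\<in>\<E>. ilen R)"
          using Ed by (intro sum.cong refl mass_one) auto
        moreover have "mass (\<lambda>_. 1 :: real) D = measure lebesgue D"
          using D by (simp add: set_lebesgue_integral_def)
        ultimately show ?thesis
          using split[OF dyadic_integrable_one] mass_one[OF Qy] by simp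
      qed
      then show ?thesis using E(5) by simp
    qed
    have stepU: "(mass \<phi> Q / mass \<sigma> Q)\<^sup>2 * mass \<sigma> D / 4 \<le> U Q - (\<Sum>R\<in>\<E>. U R)"
      unfolding U_def
      by (rule energy_step[OF split[OF phi(1)] split[OF w(2)] split[OF phi(3)] spos[OF Qy] _ bp[OF D Qy]])
        (use spos Ed in auto)
    have stepV: "(mass \<psi> Q / mass w Q)\<^sup>2 * mass w D / 4 \<le> V Q - (\<Sum>R\<in>\<E>. V R)"
      unfolding V_def
      by (rule energy_step[OF split[OF psi(1)] split[OF w(1)] split[OF psi(3)] wpos[OF Qy] _ bq[OF D Qy]])
        (use wpos Ed in auto)
    define \<alpha> \<beta> where "\<alpha> = mass \<phi> Q / mass \<sigma> Q" and "\<beta> = mass \<psi> Q / mass w Q"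
    have ab: "0 \<le> \<alpha>" "0 \<le> \<beta>"
      unfolding \<alpha>_def \<beta>_def using mass_nonneg[of \<phi> Q] mass_nonneg[of \<psi> Q] phi psi spos[OF Qy] wpos[OF Qy] by simp_all
    have "mass \<phi> Q * mass \<psi> Q / ilen Q = \<alpha> * \<beta> * (mass w Q * mass \<sigma> Q) / ilen Q"
      using spos[OF Qy] wpos[OF Qy] by (simp add: \<alpha>_def \<beta>_def)
    also have "\<dots> \<le> \<alpha> * \<beta> * (A * (ilen Q)\<^sup>2) / ilen Q"
      using ab lQ by (intro divide_right_mono mult_left_mono A Qy) auto
    also have "\<dots> = A * (\<alpha> * \<beta> * ilen Q)" using lQ by (simp add: power2_eq_square)
    also have "\<dots> \<le> A * (\<alpha> * \<beta> * (2 * measure lebesgue D))"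
      using ab A0 by (intro mult_left_mono sizeD) auto
    also have "\<dots> = A * (2 * \<alpha> * \<beta> * measure lebesgue D)" by simp
    also have "\<dots> \<le> A * (s * \<alpha>\<^sup>2 * mass \<sigma> D + \<beta>\<^sup>2 / s * mass w D)"
      unfolding \<sigma>_def using A0 w
      by (intro mult_left_mono weight_pair_bound[OF D Qy _ _ _ s]) (auto simp: \<sigma>_def)
    also have "\<dots> = 4 * A * (s * (\<alpha>\<^sup>2 * mass \<sigma> D / 4) + (\<beta>\<^sup>2 * mass w D / 4) / s)"
      using s by (simp add: field_simps)
    also have "\<dots> \<le> 4 * A * (s * (U Q - (\<Sum>R\<in>\<E>. U R)) + (V Q - (\<Sum>R\<in>\<E>. V R)) / s)"
      using stepU stepV A0 s unfolding \<alpha>_def[symmetric] \<beta>_def[symmetric]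
      by (intro mult_left_mono add_mono divide_right_mono) auto
    also have "\<dots> = 4 * A * (B Q - (\<Sum>R\<in>\<E>. B R))"
      by (simp add: B_def sum.distrib sum_distrib_left sum_divide_distrib[symmetric] algebra_simps diff_divide_distrib)
    finally have key: "mass \<phi> Q * mass \<psi> Q / ilen Q \<le> 4 * A * (B Q - (\<Sum>R\<in>\<E>. B R))" .
    have IH: "(\<Sum>L\<in>{L \<in> \<L>. L \<subseteq> R}. T L) \<le> 4 * K * A * B R" if R: "R \<in> \<E>" for R
    proof (rule Suc.IH)
      show Ry: "R \<in> dyadic" using R Ed by auto
      have "2 * ilen R \<le> 2 * (\<Sum>R\<in>\<E>. ilen R)"
        using member_le_sum[OF R, of ilen] E(1) Ed ilen_pos by (auto simp: less_imp_le subset_iff)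
      then show "ilen R < \<delta> * 2 ^ n" using E(5) Suc.prems(2) by simp
    qed
    have part: "{L \<in> \<L>. L \<subseteq> Q} = {L \<in> \<L>. L \<subseteq> Q \<and> (\<forall>R\<in>\<E>. \<not> L \<subseteq> R)} \<union> (\<Union>R\<in>\<E>. {L \<in> \<L>. L \<subseteq> R})"
      using EQ by auto
    have "(\<Sum>L\<in>{L \<in> \<L>. L \<subseteq> Q}. T L) =
        (\<Sum>L\<in>{L \<in> \<L>. L \<subseteq> Q \<and> (\<forall>R\<in>\<E>. \<not> L \<subseteq> R)}. T L) + (\<Sum>L\<in>(\<Union>R\<in>\<E>. {L \<in> \<L>. L \<subseteq> R}). T L)"
      unfolding part using L(1) E(1) by (intro sum.union_disjoint) auto
    also have "(\<Sum>L\<in>(\<Union>R\<in>\<E>. {L \<in> \<L>. L \<subseteq> R}). T L) = (\<Sum>R\<in>\<E>. \<Sum>L\<in>{L \<in> \<L>. L \<subseteq> R}. T L)"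
    proof (rule sum.UNION_disjoint)
      show "\<forall>R\<in>\<E>. \<forall>R'\<in>\<E>. R \<noteq> R' \<longrightarrow> {L \<in> \<L>. L \<subseteq> R} \<inter> {L \<in> \<L>. L \<subseteq> R'} = {}"
      proof (intro ballI impI)
        fix R R' assume R: "R \<in> \<E>" "R' \<in> \<E>" "R \<noteq> R'"
        then have "R \<inter> R' = {}" using E(3) by (auto simp: disjoint_def)
        then show "{L \<in> \<L>. L \<subseteq> R} \<inter> {L \<in> \<L>. L \<subseteq> R'} = {}"
          using L(2) dyadic_nonempty by fastforce
      qed
    qed (use E L in auto)
    also have "\<dots> \<le> (\<Sum>R\<in>\<E>. 4 * K * A * B R)" by (intro sum_mono IH)
    finally have "(\<Sum>L\<in>{L \<in> \<L>. L \<subseteq> Q}. T L) \<le> K * (mass \<phi> Q * mass \<psi> Q / ilen Q) + 4 * K * A * (\<Sum>R\<in>\<E>. B R)"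
      using loc by (simp add: sum_distrib_left)
    also have "\<dots> \<le> K * (4 * A * (B Q - (\<Sum>R\<in>\<E>. B R))) + 4 * K * A * (\<Sum>R\<in>\<E>. B R)"
      by (intro add_right_mono mult_left_mono key K)
    also have "\<dots> = 4 * K * A * B Q" by (simp add: algebra_simps)
    finally show ?case .
  qed
  obtain n where "ilen Q0 / \<delta> < 2 ^ n" using real_arch_pow[of 2] by force
  then have "ilen Q0 < \<delta> * 2 ^ n" using d(1) by (simp add: field_simps)
  from main[OF Q0 this] have "(\<Sum>L\<in>{L \<in> \<L>. L \<subseteq> Q0}. T L) \<le> 4 * K * A * B Q0" .
  also have "\<dots> \<le> 4 * K * A * (s * mass ?p Q0 + mass ?q Q0 / s)"
    unfolding B_def using K A0 s UV[OF Q0] by (intro mult_left_mono add_mono divide_right_mono) auto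
  finally show ?thesis .
qed

section \<open>The bilinear estimate\<close>

lemma norm_mass_le:
  fixes f :: "real \<Rightarrow> complex"
  shows "cmod (mass f A) \<le> mass (\<lambda>x. cmod (f x)) A"
  unfolding set_lebesgue_integral_def using integral_norm_bound[of lebesgue "\<lambda>x. indicator A x *\<^sub>R f x"] by simp

lemma dyadic_integrable_cmod:
  assumes "dyadic_integrable (f :: real \<Rightarrow> complex)"
  shows "dyadic_integrable (\<lambda>x. cmod (f x))"
  unfolding dyadic_integrable_def
proof
  fix I :: "real set" assume "I \<in> dyadic"
  then have "integrable lebesgue (\<lambda>x. indicator I x *\<^sub>R f x)"
    using dyadic_integrableD[OF assms] by (simp add: set_integrable_def)
  from integrable_norm[OF this] show "set_integrable lebesgue I (\<lambda>x. cmod (f x))"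
    by (simp add: set_integrable_def)
qed

lemma dyadic_integrable_integrable:
  assumes "integrable lebesgue (u :: real \<Rightarrow> 'a::{banach, second_countable_topology})"
  shows "dyadic_integrable u"
  unfolding dyadic_integrable_def set_integrable_def
  using assms by (auto intro!: integrable_mult_indicator)

lemma cmod_pairing_haar_le:
  assumes J: "J \<in> dyadic" and g: "dyadic_integrable g"
  shows "sqrt (ilen J) * cmod (pairing g (haar J)) \<le> mass (\<lambda>x. cmod (g x)) J"
proof -
  have "sqrt (ilen J) * cmod (pairing g (haar J)) = cmod (mass g (right_half J) - mass g (left_half J))"
    using ilen_pos[OF J] unfolding pairing_haar[OF J g] by (simp add: norm_divide)
  also have "\<dots> \<le> cmod (mass g (right_half J)) + cmod (mass g (left_half J))"
    by (rule norm_triangle_ineq4)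
  also have "\<dots> \<le> mass (\<lambda>x. cmod (g x)) (right_half J) + mass (\<lambda>x. cmod (g x)) (left_half J)"
    by (intro add_mono norm_mass_le)
  also have "\<dots> = mass (\<lambda>x. cmod (g x)) J"
    using mass_halves[OF J dyadic_integrable_cmod[OF g]] by simp
  finally show ?thesis .
qed

text \<open>For \<open>f\<close> the square sums over intervals outside the stopping family come from the packing condition on
\<open>\<beta>\<close>, for \<open>g\<close> from \<open>haar_square_sum_stopped\<close>; both are fed into \<open>scale_coef_square_sum\<close>, and the
Cauchy-Schwarz inequality over \<open>L\<close> combines them.\<close>

lemma local_estimate:
  fixes f g :: "real \<Rightarrow> complex" and \<beta> :: "real set \<Rightarrow> real"
  assumes f: "dyadic_integrable f" and g: "dyadic_integrable g"
    and beta: "\<And>I. 0 \<le> \<beta> I" "0 \<le> B"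
      "\<And>Q \<H>. Q \<in> dyadic \<Longrightarrow> finite \<H> \<Longrightarrow> \<H> \<subseteq> dyadic_sub Q \<Longrightarrow> (\<Sum>I\<in>\<H>. (\<beta> I)\<^sup>2) \<le> B\<^sup>2 * ilen Q"
    and L: "finite \<L>" "\<L> \<subseteq> dyadic"
    and Q0: "Q0 \<in> dyadic"
  defines "u \<equiv> \<lambda>I. cmod (mean I f) * \<beta> I" and "v \<equiv> \<lambda>J. cmod (pairing g (haar J))"
    and "F \<equiv> mass (\<lambda>x. cmod (f x))" and "G \<equiv> mass (\<lambda>x. cmod (g x))"
  shows "\<exists>\<E>. finite \<E> \<and> \<E> \<subseteq> dyadic_sub Q0 \<and> disjoint \<E> \<and> Q0 \<notin> \<E> \<and>
        2 * (\<Sum>Q\<in>\<E>. ilen Q) \<le> ilen Q0 \<and>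
        (\<Sum>L\<in>{L \<in> \<L>. L \<subseteq> Q0 \<and> (\<forall>Q\<in>\<E>. \<not> L \<subseteq> Q)}. scale_coef n u L * scale_coef m v L)
          \<le> (256 * real (m + n + 2) * B) * (F Q0 * G Q0 / ilen Q0)"
proof -
  have l: "0 < ilen Q0" by (rule ilen_pos[OF Q0])
  obtain d where d: "0 < d" "\<And>J. J \<in> \<L> \<Longrightarrow> d \<le> ilen J"
  proof (cases "\<L> = {}")
    case True then show thesis using that[of 1] by auto
  next
    case False
    show thesis
      by (rule that[of "Min (ilen ` \<L>)"]) (use False L ilen_pos in \<open>auto simp: subset_iff\<close>)
  qed
  \<comment> \<open>The stopping rule must also see the intervals \<open>n\<close> or \<open>m\<close> generations below each \<open>L\<close>.\<close>
  define \<delta> where "\<delta> = d / 2 ^ (m + n)"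
  have dpos: "0 < \<delta>" using d by (simp add: \<delta>_def)
  have dge: "\<delta> \<le> ilen I" if "L \<in> \<L>" "I \<in> dyadic_gen k L" "k \<le> m + n" for I L k
  proof -
    have "\<delta> \<le> d / 2 ^ k" unfolding \<delta>_def using d(1) that(3) by (intro divide_left_mono) auto
    also have "\<dots> \<le> ilen I" using dyadic_genD(3)[OF that(2)] d(2)[OF that(1)] by (simp add: divide_right_mono)
    finally show ?thesis .
  qed
  note fc = dyadic_integrable_cmod[OF f] and gc = dyadic_integrable_cmod[OF g]
  obtain \<E> where E: "finite \<E>" "\<E> \<subseteq> dyadic_sub Q0" "disjoint \<E>" "Q0 \<notin> \<E>" "2 * (\<Sum>Q\<in>\<E>. ilen Q) \<le> ilen Q0"
    and avg: "\<And>J. J \<in> dyadic_sub Q0 \<Longrightarrow> \<delta> \<le> ilen J \<Longrightarrow> (\<And>Q. Q \<in> \<E> \<Longrightarrow> \<not> J \<subseteq> Q) \<Longrightarrow>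
      F J \<le> 4 * (F Q0 / ilen Q0) * ilen J \<and> G J \<le> 4 * (G Q0 / ilen Q0) * ilen J"
    and stop: "\<And>Q. Q \<in> \<E> \<Longrightarrow> F Q \<le> 8 * (F Q0 / ilen Q0) * ilen Q \<and> G Q \<le> 8 * (G Q0 / ilen Q0) * ilen Q"
    unfolding F_def G_def
    by (rule stopping_family[OF Q0 dpos fc _ gc]) auto
  define a b where "a = F Q0 / ilen Q0" and "b = G Q0 / ilen Q0"
  have FG0: "0 \<le> F Q" "0 \<le> G Q" for Q by (auto simp: F_def G_def intro!: mass_nonneg)
  have ab: "0 \<le> a" "0 \<le> b" using FG0[of Q0] l by (simp_all add: a_def b_def)
  define \<S> where "\<S> = {L \<in> \<L>. L \<subseteq> Q0 \<and> (\<forall>Q\<in>\<E>. \<not> L \<subseteq> Q)}"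
  have S: "finite \<S>" "\<S> \<subseteq> dyadic_sub Q0" "\<And>L Q. L \<in> \<S> \<Longrightarrow> Q \<in> \<E> \<Longrightarrow> \<not> L \<subseteq> Q" "\<S> \<subseteq> \<L>"
    using L by (auto simp: \<S>_def dyadic_sub_def)
  have gen_sub: "I \<in> dyadic_sub Q0" if "L \<in> \<S>" "I \<in> dyadic_gen k L" for I L k
    using dyadic_genD[OF that(2)] that(1) by (auto simp: \<S>_def dyadic_sub_def)
  have SA: "(\<Sum>L\<in>\<S>. (scale_coef n u L)\<^sup>2) \<le> 256 * real (n + 1) * (B * a)\<^sup>2 * ilen Q0"
  proof (rule scale_coef_square_sum[OF Q0 E(1-3) S(1-3) fc])
    show "0 \<le> u I" for I using beta(1) by (simp add: u_def)
    show "sqrt (ilen I) * u I \<le> B * mass (\<lambda>x. cmod (f x)) I" if I: "I \<in> dyadic" for I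
    proof -
      have lI: "0 < ilen I" by (rule ilen_pos[OF I])
      have "(\<Sum>I\<in>{I}. (\<beta> I)\<^sup>2) \<le> B\<^sup>2 * ilen I"
        by (rule beta(3)) (use I in \<open>auto simp: dyadic_sub_def\<close>)
      then have "(\<beta> I)\<^sup>2 \<le> (B * sqrt (ilen I))\<^sup>2" using lI by (simp add: power_mult_distrib)
      then have bI: "\<beta> I \<le> B * sqrt (ilen I)"
        by (rule power2_le_imp_le) (use beta(2) lI in auto)
      have "cmod (mean I f) \<le> mass (\<lambda>x. cmod (f x)) I / ilen I"
        unfolding mean_def using norm_mass_le[of I f] lI by (simp add: norm_divide divide_right_mono)
      then have "sqrt (ilen I) * u I \<le> sqrt (ilen I) * (mass (\<lambda>x. cmod (f x)) I / ilen I * (B * sqrt (ilen I)))"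
        unfolding u_def using bI beta(1) lI FG0(1)[of I]
        by (intro mult_left_mono mult_mono) (auto simp: F_def)
      also have "\<dots> = B * mass (\<lambda>x. cmod (f x)) I * (sqrt (ilen I) * sqrt (ilen I)) / ilen I" by simp
      also have "\<dots> = B * mass (\<lambda>x. cmod (f x)) I" using lI by simp
      finally show ?thesis .
    qed
    show "mass (\<lambda>x. cmod (f x)) Q \<le> 8 * a * ilen Q" if "Q \<in> \<E>" for Q
      using stop[OF that] by (simp add: F_def a_def)
    fix \<H> assume H: "finite \<H>" "\<H> \<subseteq> (\<Union>L\<in>\<S>. dyadic_gen n L)" "\<And>I Q. I \<in> \<H> \<Longrightarrow> Q \<in> \<E> \<Longrightarrow> \<not> I \<subseteq> Q"
    have Hs: "\<H> \<subseteq> dyadic_sub Q0" using H(2) gen_sub by blast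
    have "(u I)\<^sup>2 \<le> (4 * a)\<^sup>2 * (\<beta> I)\<^sup>2" if I: "I \<in> \<H>" for I
    proof -
      obtain L where "L \<in> \<S>" "I \<in> dyadic_gen n L" using H(2) I by blast
      then have "F I \<le> 4 * a * ilen I"
        using avg[of I] dge[of L I n] H(3)[OF I] Hs I S(4) by (auto simp: a_def)
      moreover have lI: "0 < ilen I" using Hs I ilen_pos by (auto simp: dyadic_sub_def)
      ultimately have "cmod (mean I f) \<le> 4 * a"
        unfolding mean_def using norm_mass_le[of I f] by (simp add: norm_divide F_def divide_le_eq)
      then show ?thesis unfolding u_def power_mult_distrib[symmetric] using beta(1)
        by (intro power_mono mult_right_mono) auto
    qed
    then have "(\<Sum>I\<in>\<H>. (u I)\<^sup>2) \<le> (\<Sum>I\<in>\<H>. (4 * a)\<^sup>2 * (\<beta> I)\<^sup>2)" by (rule sum_mono)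
    also have "\<dots> = (4 * a)\<^sup>2 * (\<Sum>I\<in>\<H>. (\<beta> I)\<^sup>2)" by (simp add: sum_distrib_left)
    also have "\<dots> \<le> (4 * a)\<^sup>2 * (B\<^sup>2 * ilen Q0)" by (intro mult_left_mono beta(3) Q0 H Hs) auto
    also have "\<dots> \<le> 64 * (B * a)\<^sup>2 * ilen Q0" using l by (simp add: power_mult_distrib)
    finally show "(\<Sum>I\<in>\<H>. (u I)\<^sup>2) \<le> 64 * (B * a)\<^sup>2 * ilen Q0" .
  qed (use ab beta in auto)
  have SB: "(\<Sum>L\<in>\<S>. (scale_coef m v L)\<^sup>2) \<le> 256 * real (m + 1) * (1 * b)\<^sup>2 * ilen Q0"
  proof (rule scale_coef_square_sum[OF Q0 E(1-3) S(1-3) gc])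
    show "sqrt (ilen J) * v J \<le> 1 * mass (\<lambda>x. cmod (g x)) J" if "J \<in> dyadic" for J
      using cmod_pairing_haar_le[OF that g] by (simp add: v_def)
    show "mass (\<lambda>x. cmod (g x)) Q \<le> 8 * b * ilen Q" if "Q \<in> \<E>" for Q
      using stop[OF that] by (simp add: G_def b_def)
    fix \<H> assume H: "finite \<H>" "\<H> \<subseteq> (\<Union>L\<in>\<S>. dyadic_gen m L)" "\<And>I Q. I \<in> \<H> \<Longrightarrow> Q \<in> \<E> \<Longrightarrow> \<not> I \<subseteq> Q"
    define \<G> where "\<G> = {J \<in> dyadic_sub Q0. \<delta> \<le> ilen J \<and> (\<forall>Q\<in>\<E>. \<not> J \<subseteq> Q)}"
    have HG: "\<H> \<subseteq> \<G>"
    proof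
      fix J assume J: "J \<in> \<H>"
      then obtain L where "L \<in> \<S>" "J \<in> dyadic_gen m L" using H(2) by blast
      then show "J \<in> \<G>" using gen_sub dge[of L J m] H(3)[OF J] S(4) by (auto simp: \<G>_def)
    qed
    have "(\<Sum>J\<in>\<H>. (v J)\<^sup>2) \<le> (8 * b)\<^sup>2 * ilen Q0"
      unfolding v_def
    proof (rule haar_square_sum_stopped[OF Q0 g H(1) HG])
      show "\<G> \<subseteq> dyadic_sub Q0" by (auto simp: \<G>_def)
      show "J' \<in> \<G>" if "J \<in> \<G>" "J' \<in> dyadic_sub Q0" "J \<subseteq> J'" for J J'
        using that dyadic_ilen_mono[of J J'] by (fastforce simp: \<G>_def dyadic_sub_def)
      have "G Q0 \<le> 8 * b * ilen Q0" using l FG0(2)[of Q0] by (simp add: b_def)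
      then show "cmod (mass g Q0) \<le> 8 * b * ilen Q0" using norm_mass_le[of Q0 g] by (simp add: G_def)
      fix J J' assume J: "J \<in> \<G>" "J' \<in> dyadic_gen 1 J"
      have Jy: "J \<in> dyadic" using J(1) by (auto simp: \<G>_def dyadic_sub_def)
      have "cmod (mass g J') \<le> G J'" unfolding G_def by (rule norm_mass_le)
      also have "\<dots> \<le> G J"
        unfolding G_def using dyadic_genD[OF J(2)]
        by (intro mass_subset_mono dyadic_integrableD[OF gc Jy]) auto
      also have "\<dots> \<le> 4 * b * ilen J" using avg[of J] J(1) by (auto simp: \<G>_def b_def)
      also have "\<dots> = 8 * b * ilen J'" using dyadic_genD(3)[OF J(2)] by simp
      finally show "cmod (mass g J') \<le> 8 * b * ilen J'" .
    qed
    then show "(\<Sum>J\<in>\<H>. (v J)\<^sup>2) \<le> 64 * (1 * b)\<^sup>2 * ilen Q0" by (simp add: power_mult_distrib)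
  qed (use ab in \<open>auto simp: v_def\<close>)
  have "(\<Sum>L\<in>\<S>. scale_coef n u L * scale_coef m v L)\<^sup>2 \<le>
      (\<Sum>L\<in>\<S>. (scale_coef n u L)\<^sup>2) * (\<Sum>L\<in>\<S>. (scale_coef m v L)\<^sup>2)"
    by (rule Cauchy_Schwarz_ineq_sum)
  also have "\<dots> \<le> (256 * real (n + 1) * (B * a)\<^sup>2 * ilen Q0) * (256 * real (m + 1) * (1 * b)\<^sup>2 * ilen Q0)"
    using l by (intro mult_mono SA SB sum_nonneg) auto
  also have "\<dots> = (real (n + 1) * real (m + 1)) * (256 * B * a * b * ilen Q0)\<^sup>2"
    by (simp add: power2_eq_square algebra_simps)
  also have "\<dots> \<le> (real (m + n + 2))\<^sup>2 * (256 * B * a * b * ilen Q0)\<^sup>2"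
  proof (rule mult_right_mono)
    show "real (n + 1) * real (m + 1) \<le> (real (m + n + 2))\<^sup>2"
      by (simp add: power2_eq_square algebra_simps)
  qed simp
  also have "\<dots> = ((256 * real (m + n + 2) * B) * (a * b * ilen Q0))\<^sup>2"
    unfolding power_mult_distrib by simp
  finally have "(\<Sum>L\<in>\<S>. scale_coef n u L * scale_coef m v L) \<le> (256 * real (m + n + 2) * B) * (a * b * ilen Q0)"
    by (rule power2_le_imp_le) (use ab beta(2) l in auto)
  also have "a * b * ilen Q0 = F Q0 * G Q0 / ilen Q0" using l by (simp add: a_def b_def)
  finally show ?thesis using E unfolding \<S>_def by blast
qed

lemma bilinear_estimate:
  fixes w :: "real \<Rightarrow> real" and f g :: "real \<Rightarrow> complex" and \<beta> :: "real set \<Rightarrow> real"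
  defines "\<sigma> \<equiv> \<lambda>x. inverse (w x)"
  assumes w: "dyadic_integrable w" "dyadic_integrable \<sigma>" "AE x in lebesgue. 0 < w x"
    and A: "\<And>I. I \<in> dyadic \<Longrightarrow> mass w I * mass \<sigma> I \<le> A * (ilen I)\<^sup>2" "0 \<le> A"
    and beta: "\<And>I. 0 \<le> \<beta> I" "0 \<le> B"
      "\<And>Q \<H>. Q \<in> dyadic \<Longrightarrow> finite \<H> \<Longrightarrow> \<H> \<subseteq> dyadic_sub Q \<Longrightarrow> (\<Sum>I\<in>\<H>. (\<beta> I)\<^sup>2) \<le> B\<^sup>2 * ilen Q"
    and f: "dyadic_integrable f" "integrable lebesgue (\<lambda>x. (cmod (f x))\<^sup>2 * w x)"
    and g: "dyadic_integrable g" "integrable lebesgue (\<lambda>x. (cmod (g x))\<^sup>2 * \<sigma> x)"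
    and L: "finite \<L>" "\<L> \<subseteq> dyadic" and s: "0 < s"
  shows "(\<Sum>L\<in>\<L>. scale_coef n (\<lambda>I. cmod (mean I f) * \<beta> I) L * scale_coef m (\<lambda>J. cmod (pairing g (haar J))) L)
    \<le> 1024 * real (m + n + 2) * B * A *
        (s * (LINT x|lebesgue. (cmod (f x))\<^sup>2 * w x) + (LINT x|lebesgue. (cmod (g x))\<^sup>2 * \<sigma> x) / s)"
proof -
  let ?T = "\<lambda>L. scale_coef n (\<lambda>I. cmod (mean I f) * \<beta> I) L * scale_coef m (\<lambda>J. cmod (pairing g (haar J))) L"
  let ?p = "\<lambda>x. (cmod (f x))\<^sup>2 * w x" and ?q = "\<lambda>x. (cmod (g x))\<^sup>2 * \<sigma> x"
  define K where "K = 256 * real (m + n + 2) * B"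
  have K: "0 \<le> K" using beta by (simp add: K_def)
  have p: "dyadic_integrable ?p" and q: "dyadic_integrable ?q"
    using dyadic_integrable_integrable f(2) g(2) by auto
  have each: "(\<Sum>L\<in>{L \<in> \<L>. L \<subseteq> Q}. ?T L) \<le> 4 * K * A * (s * mass ?p Q + mass ?q Q / s)" if Q: "Q \<in> dyadic" for Q
    unfolding \<sigma>_def
    by (rule bellman_induction[OF w(1) w(2)[unfolded \<sigma>_def] w(3) A(1)[unfolded \<sigma>_def]
          dyadic_integrable_cmod[OF f(1)] _ p dyadic_integrable_cmod[OF g(1)] _ q[unfolded \<sigma>_def] L K s _ Q])
      (use local_estimate[OF f(1) g(1) beta L, of _ n m] in \<open>auto simp: K_def\<close>)
  \<comment> \<open>The maximal members of \<open>\<L>\<close> are disjoint, so the energies over them add up to at most the total energy.\<close>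
  obtain \<M> where M: "\<M> \<subseteq> \<L>" "disjoint \<M>" "\<And>L. L \<in> \<L> \<Longrightarrow> \<exists>Q\<in>\<M>. L \<subseteq> Q"
    using dyadic_maximal_elements[OF L] by metis
  have fM: "finite \<M>" and Md: "\<M> \<subseteq> dyadic" using M(1) L finite_subset by auto
  have "(\<Sum>L\<in>\<L>. ?T L) = (\<Sum>L\<in>(\<Union>Q\<in>\<M>. {L \<in> \<L>. L \<subseteq> Q}). ?T L)"
    using M(3) by (intro sum.cong) auto
  also have "\<dots> = (\<Sum>Q\<in>\<M>. \<Sum>L\<in>{L \<in> \<L>. L \<subseteq> Q}. ?T L)"
  proof (rule sum.UNION_disjoint)
    show "\<forall>R\<in>\<M>. \<forall>R'\<in>\<M>. R \<noteq> R' \<longrightarrow> {L \<in> \<L>. L \<subseteq> R} \<inter> {L \<in> \<L>. L \<subseteq> R'} = {}"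
    proof (intro ballI impI)
      fix R R' assume R: "R \<in> \<M>" "R' \<in> \<M>" "R \<noteq> R'"
      then have "R \<inter> R' = {}" using M(2) by (auto simp: disjoint_def)
      then show "{L \<in> \<L>. L \<subseteq> R} \<inter> {L \<in> \<L>. L \<subseteq> R'} = {}"
        using L(2) dyadic_nonempty by fastforce
    qed
  qed (use fM L in auto)
  also have "\<dots> \<le> (\<Sum>Q\<in>\<M>. 4 * K * A * (s * mass ?p Q + mass ?q Q / s))"
    using Md by (intro sum_mono each) auto
  also have "\<dots> = 4 * K * A * (s * (\<Sum>Q\<in>\<M>. mass ?p Q) + (\<Sum>Q\<in>\<M>. mass ?q Q) / s)"
    by (simp only: sum_distrib_left[symmetric] sum.distrib sum_divide_distrib[symmetric])
  also have "\<dots> \<le> 4 * K * A * (s * (LINT x|lebesgue. ?p x) + (LINT x|lebesgue. ?q x) / s)"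
  proof -
    have le: "(\<Sum>Q\<in>\<M>. mass u Q) \<le> (LINT x|lebesgue. u x)"
      if u: "integrable lebesgue u" "AE x in lebesgue. 0 \<le> u x" for u :: "real \<Rightarrow> real"
    proof -
      note U = mass_Union[OF fM Md M(2) dyadic_integrable_integrable[OF u(1)]]
      have "(\<Sum>Q\<in>\<M>. mass u Q) = (LINT x|lebesgue. indicator (\<Union>\<M>) x *\<^sub>R u x)"
        using U(1) by (simp add: set_lebesgue_integral_def)
      also have "\<dots> \<le> (LINT x|lebesgue. u x)"
      proof (rule integral_mono_AE)
        show "integrable lebesgue (\<lambda>x. indicator (\<Union>\<M>) x *\<^sub>R u x)" using U(2) by (simp add: set_integrable_def)
        show "AE x in lebesgue. indicator (\<Union>\<M>) x *\<^sub>R u x \<le> u x"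
          using u(2) by eventually_elim (auto split: split_indicator)
      qed (rule u(1))
      finally show ?thesis .
    qed
    have "AE x in lebesgue. 0 \<le> ?p x" "AE x in lebesgue. 0 \<le> ?q x"
      using w(3) by (auto elim!: eventually_mono simp: \<sigma>_def)
    then show ?thesis using s K A(2) f(2) g(2)
      by (intro mult_left_mono add_mono divide_right_mono le) auto
  qed
  also have "4 * K = 1024 * real (m + n + 2) * B" by (simp add: K_def)
  finally show ?thesis .
qed

section \<open>Duality and finite partial sums\<close>

lemma locally_integrable_measurable:
  assumes "locally_integrable (u :: real \<Rightarrow> 'a::{banach, second_countable_topology})"
  shows "u \<in> borel_measurable lebesgue"
proof (rule borel_measurable_LIMSEQ_metric)
  fix i :: nat
  have "set_integrable lebesgue {- real i..real i} u"
    using assms by (simp add: locally_integrable_def)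
  then show "(\<lambda>x. indicator {- real i..real i} x *\<^sub>R u x) \<in> borel_measurable lebesgue"
    unfolding set_integrable_def by (rule borel_measurable_integrable)
next
  fix x :: real
  have "eventually (\<lambda>i. indicator {- real i..real i} x *\<^sub>R u x = u x) sequentially"
    using eventually_ge_at_top[of "nat \<lceil>\<bar>x\<bar>\<rceil>"] by eventually_elim (auto split: split_indicator)
  then show "(\<lambda>i. indicator {- real i..real i} x *\<^sub>R u x) \<longlonglongrightarrow> u x"
    by (rule tendsto_eventually)
qed

lemma locally_integrable_dyadic:
  assumes "locally_integrable u" shows "dyadic_integrable u"
  unfolding dyadic_integrable_def
proof
  fix I assume I: "I \<in> dyadic"
  obtain K where K: "compact K" "I \<subseteq> K" using dyadic_in_compact[OF I] .
  show "set_integrable lebesgue I u"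
    by (rule set_integrable_subset[of _ K]) (use assms K I in \<open>auto simp: locally_integrable_def\<close>)
qed

lemma ext_mean_eq:
  assumes "I \<in> dyadic" "set_integrable lebesgue I u" "AE x in lebesgue. 0 \<le> u x"
  shows "ext_mean I u = ennreal (mass u I / ilen I)"
proof -
  have nn: "AE x in lebesgue. 0 \<le> indicator I x *\<^sub>R u x"
    using assms(3) by eventually_elim (auto split: split_indicator)
  have "(\<integral>\<^sup>+x\<in>I. ennreal (u x) \<partial>lebesgue) = (\<integral>\<^sup>+x. ennreal (indicator I x *\<^sub>R u x) \<partial>lebesgue)"
    by (intro nn_integral_cong) (auto split: split_indicator)
  also have "\<dots> = ennreal (mass u I)"
    unfolding set_lebesgue_integral_def
    by (rule nn_integral_eq_integral) (use assms(2) nn in \<open>auto simp: set_integrable_def\<close>)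
  moreover have "0 \<le> mass u I" unfolding set_lebesgue_integral_def by (rule integral_nonneg_AE[OF nn])
  ultimately show ?thesis
    unfolding ext_mean_def using ilen_pos[OF assms(1)] by (simp add: divide_ennreal)
qed

text \<open>The second factor of the A2 condition is finite because the first one is not zero; hence \<open>1/w\<close> is integrable
over dyadic intervals and both means are quotients of Bochner integrals.\<close>

lemma A2d_properties:
  assumes "w \<in> A2d"
  shows "w \<in> borel_measurable lebesgue" "AE x in lebesgue. 0 < w x" "dyadic_integrable w"
    "dyadic_integrable (\<lambda>x. inverse (w x))"
    "I \<in> dyadic \<Longrightarrow> mass w I * mass (\<lambda>x. inverse (w x)) I \<le> A2_char w * (ilen I)\<^sup>2"
    "0 \<le> A2_char w"
proof -
  have li: "locally_integrable w" and pos: "AE x in lebesgue. 0 < w x" and fin: "A2_sup w < \<infinity>"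
    using assms by (auto simp: A2d_def weight_def)
  show meas[measurable]: "w \<in> borel_measurable lebesgue" by (rule locally_integrable_measurable[OF li])
  show "AE x in lebesgue. 0 < w x" by (rule pos)
  show w: "dyadic_integrable w" by (rule locally_integrable_dyadic[OF li])
  have nn: "AE x in lebesgue. 0 \<le> w x" "AE x in lebesgue. 0 \<le> inverse (w x)"
    using pos by (auto elim: eventually_mono)
  have le: "ext_mean I w * ext_mean I (\<lambda>x. inverse (w x)) \<le> A2_sup w" if "I \<in> dyadic" for I
    unfolding A2_sup_def using that by (rule SUP_upper)
  show inv: "dyadic_integrable (\<lambda>x. inverse (w x))"
    unfolding dyadic_integrable_def set_integrable_def
  proof
    fix I assume I: "I \<in> dyadic"
    have e: "ext_mean I w = ennreal (mass w I / ilen I)"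
      by (rule ext_mean_eq[OF I dyadic_integrableD[OF w I] nn(1)])
    have "0 < mass w I / ilen I" using mass_pos[OF I w pos] ilen_pos[OF I] by simp
    then have "ext_mean I w \<noteq> 0" by (simp only: e ennreal_eq_0_iff not_le)
    moreover have "ext_mean I w * ext_mean I (\<lambda>x. inverse (w x)) < \<infinity>"
      using le[OF I] fin by (rule le_less_trans)
    ultimately have "ext_mean I (\<lambda>x. inverse (w x)) < \<infinity>"
      by (auto simp: ennreal_mult_less_top)
    then have f: "(\<integral>\<^sup>+x\<in>I. ennreal (inverse (w x)) \<partial>lebesgue) < \<infinity>"
      unfolding ext_mean_def by (auto simp: less_top[symmetric] ennreal_top_divide)
    show "integrable lebesgue (\<lambda>x. indicator I x *\<^sub>R inverse (w x))"
    proof (rule integrableI_nonneg)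
      show "(\<lambda>x. indicator I x *\<^sub>R inverse (w x)) \<in> borel_measurable lebesgue"
        using I meas by (intro borel_measurable_scaleR borel_measurable_indicator borel_measurable_inverse) auto
      show "AE x in lebesgue. 0 \<le> indicator I x *\<^sub>R inverse (w x)"
        using nn(2) by eventually_elim (auto split: split_indicator)
      have "(\<integral>\<^sup>+x. ennreal (indicator I x *\<^sub>R inverse (w x)) \<partial>lebesgue) = (\<integral>\<^sup>+x\<in>I. ennreal (inverse (w x)) \<partial>lebesgue)"
        by (intro nn_integral_cong) (auto split: split_indicator)
      then show "(\<integral>\<^sup>+x. ennreal (indicator I x *\<^sub>R inverse (w x)) \<partial>lebesgue) < \<infinity>" using f by simp
    qed
  qed
  show "0 \<le> A2_char w" by (simp add: A2_char_def)
  assume I: "I \<in> dyadic"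
  let ?a = "mass w I / ilen I" and ?b = "mass (\<lambda>x. inverse (w x)) I / ilen I"
  have ab: "0 \<le> ?a" "0 \<le> ?b"
    using nn ilen_pos[OF I] unfolding set_lebesgue_integral_def
    by (auto intro!: divide_nonneg_pos integral_nonneg_AE elim!: eventually_mono)
  have "ennreal (?a * ?b) = ext_mean I w * ext_mean I (\<lambda>x. inverse (w x))"
    using ext_mean_eq[OF I dyadic_integrableD[OF w I] nn(1)] ext_mean_eq[OF I dyadic_integrableD[OF inv I] nn(2)]
    by (simp only: ennreal_mult[OF ab])
  also have "\<dots> \<le> A2_sup w" by (rule le[OF I])
  finally have "enn2real (ennreal (?a * ?b)) \<le> A2_char w"
    unfolding A2_char_def using fin by (intro enn2real_mono) auto
  then have "?a * ?b \<le> A2_char w" using mult_nonneg_nonneg[OF ab] by (simp only: enn2real_ennreal)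
  then show "mass w I * mass (\<lambda>x. inverse (w x)) I \<le> A2_char w * (ilen I)\<^sup>2"
    using ilen_pos[OF I] by (simp add: field_simps power2_eq_square)
qed

lemma BMOd_carleson:
  assumes b: "b \<in> BMOd" and Q: "Q \<in> dyadic" and H: "finite \<H>" "\<H> \<subseteq> dyadic_sub Q"
  shows "(\<Sum>I\<in>\<H>. (cmod (pairing b (haar I)))\<^sup>2) \<le> (BMO_norm b)\<^sup>2 * ilen Q"
proof -
  let ?f = "\<lambda>I. (cmod (pairing b (haar I)))\<^sup>2"
  have l: "0 < ilen Q" by (rule ilen_pos[OF Q])
  have fin: "BMO_sup b < \<infinity>" using b by (simp add: BMOd_def)
  have "ennreal (\<Sum>I\<in>\<H>. ?f I) = (\<Sum>I\<in>\<H>. ennreal (?f I))" by (simp add: sum_ennreal)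
  also have "\<dots> \<le> (\<Sum>\<^sub>\<infinity>I\<in>dyadic_sub Q. ennreal (?f I))"
    using H by (subst nonneg_infsum_complete) (auto intro!: SUP_upper)
  finally have "ennreal (\<Sum>I\<in>\<H>. ?f I) / ennreal (ilen Q) \<le> (\<Sum>\<^sub>\<infinity>I\<in>dyadic_sub Q. ennreal (?f I)) / ennreal (ilen Q)"
    by (rule divide_right_mono_ennreal)
  also have "\<dots> \<le> BMO_sup b" unfolding BMO_sup_def using Q by (rule SUP_upper)
  finally have "ennreal ((\<Sum>I\<in>\<H>. ?f I) / ilen Q) \<le> BMO_sup b"
    using l by (simp add: divide_ennreal sum_nonneg)
  then have "enn2real (ennreal ((\<Sum>I\<in>\<H>. ?f I) / ilen Q)) \<le> enn2real (BMO_sup b)"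
    using fin by (intro enn2real_mono) auto
  moreover have "0 \<le> (\<Sum>I\<in>\<H>. ?f I) / ilen Q" using l by (simp add: sum_nonneg)
  ultimately have "(\<Sum>I\<in>\<H>. ?f I) / ilen Q \<le> enn2real (BMO_sup b)" by (simp only: enn2real_ennreal)
  then show ?thesis using l by (simp add: BMO_norm_def field_simps)
qed

text \<open>Pointwise \<open>2 |f| \<le> |f|^2 w + 1/w\<close>.\<close>

lemma L2w_dyadic_integrable:
  assumes w: "w \<in> A2d" and f: "f \<in> L2w w"
  shows "dyadic_integrable f"
  unfolding dyadic_integrable_def
proof
  fix I assume I: "I \<in> dyadic"
  note W = A2d_properties[OF w]
  have m[measurable]: "f \<in> borel_measurable lebesgue" and i: "integrable lebesgue (\<lambda>x. (cmod (f x))\<^sup>2 * w x)"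
    using f by (auto simp: L2w_def)
  show "set_integrable lebesgue I f"
    unfolding set_integrable_def
  proof (rule Bochner_Integration.integrable_bound)
    show "integrable lebesgue (\<lambda>x. (cmod (f x))\<^sup>2 * w x + indicator I x *\<^sub>R inverse (w x))"
      using i dyadic_integrableD[OF W(4) I] by (intro Bochner_Integration.integrable_add) (auto simp: set_integrable_def)
    show "(\<lambda>x. indicator I x *\<^sub>R f x) \<in> borel_measurable lebesgue"
      using I m by (intro borel_measurable_scaleR borel_measurable_indicator) auto
    show "AE x in lebesgue. norm (indicator I x *\<^sub>R f x) \<le> norm ((cmod (f x))\<^sup>2 * w x + indicator I x *\<^sub>R inverse (w x))"
      using W(2)
    proof eventually_elim
      case (elim x)
      have "(cmod (f x))\<^sup>2 * w x + inverse (w x) - 2 * cmod (f x) = (cmod (f x) * w x - 1)\<^sup>2 / w x"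
        using elim by (simp add: field_simps power2_eq_square)
      also have "\<dots> \<ge> 0" using elim by simp
      finally have "cmod (f x) \<le> (cmod (f x))\<^sup>2 * w x + inverse (w x)" using norm_ge_zero[of "f x"] by linarith
      then show ?case using elim by (auto split: split_indicator)
    qed
  qed
qed

text \<open>For \<open>a, b > 0\<close> the choice \<open>s = b/a\<close> is optimal; if \<open>a\<close> or \<open>b\<close> vanishes, \<open>s\<close> is sent to infinity or to zero.\<close>

lemma le_geometric_mean_if_le_scaled:
  fixes X :: real
  assumes "\<And>s. 0 < s \<Longrightarrow> X \<le> k * (s * a\<^sup>2 + b\<^sup>2 / s)" "0 \<le> k" "0 \<le> a" "0 \<le> b"
  shows "X \<le> 2 * k * a * b"
proof (rule ccontr)
  assume c: "\<not> ?thesis"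
  have X: "0 < X" using c assms by (smt (verit) mult_nonneg_nonneg)
  consider "a = 0" | "b = 0" | "0 < a" "0 < b" using assms by fastforce
  then show False
  proof cases
    case 1
    define s where "s = (k * b\<^sup>2 + 1) / X"
    have s: "0 < s" using X assms by (simp add: s_def add_nonneg_pos)
    have "X * s = k * b\<^sup>2 + 1" using X by (simp add: s_def)
    moreover have "X * s \<le> k * b\<^sup>2" using assms(1)[OF s] 1 s by (simp add: field_simps)
    ultimately show False by simp
  next
    case 2
    define s where "s = X / (k * a\<^sup>2 + 1)"
    have p: "0 < k * a\<^sup>2 + 1" using assms by (simp add: add_nonneg_pos)
    then have s: "0 < s" using X by (simp add: s_def)
    have "(k * a\<^sup>2 + 1) * s = X" using p by (simp add: s_def)
    then have "X = k * a\<^sup>2 * s + s" by (simp add: algebra_simps)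
    moreover have "X \<le> k * a\<^sup>2 * s" using assms(1)[OF s] 2 by (simp add: mult_ac)
    ultimately show False using s by simp
  next
    case 3
    have "X \<le> k * (b / a * a\<^sup>2 + b\<^sup>2 / (b / a))" using 3 by (intro assms(1)) simp
    also have "\<dots> = 2 * k * a * b" using 3 by (simp add: field_simps power2_eq_square)
    finally show False using c by simp
  qed
qed

lemma integral_haar_cnj:
  assumes "J \<in> dyadic" "dyadic_integrable g"
  shows "integrable lebesgue (\<lambda>x. haar J x * cnj (g x))"
    "(LINT x|lebesgue. haar J x * cnj (g x)) = cnj (pairing g (haar J))"
proof -
  have i: "set_integrable lebesgue (right_half J) g" "set_integrable lebesgue (left_half J) g"
    using half_dyadic[OF assms(1)] dyadic_integrableD[OF assms(2)] by auto
  have e: "g x * cnj (haar J x) =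
    (indicator (right_half J) x *\<^sub>R g x - indicator (left_half J) x *\<^sub>R g x) / of_real (sqrt (ilen J))" for x
    by (auto simp: haar_def field_simps split: split_indicator)
  have g: "integrable lebesgue (\<lambda>x. g x * cnj (haar J x))"
    unfolding e using i by (simp add: set_integrable_def)
  have c: "haar J x * cnj (g x) = cnj (g x * cnj (haar J x))" for x by simp
  show "integrable lebesgue (\<lambda>x. haar J x * cnj (g x))"
    unfolding c using g by (simp only: integrable_cnj)
  show "(LINT x|lebesgue. haar J x * cnj (g x)) = cnj (pairing g (haar J))"
    unfolding c pairing_def by (rule Bochner_Integration.integral_cnj)
qed

lemma haar_measurable [measurable]: "J \<in> dyadic \<Longrightarrow> haar J \<in> borel_measurable lebesgue"
  unfolding haar_def[abs_def]
  by (intro borel_measurable_divide borel_measurable_diff borel_measurable_indicator borel_measurable_const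
      dyadic_sets half_dyadic(1,2))

lemma dyadic_integrable_haar_mult:
  assumes J: "J \<in> dyadic" and w: "dyadic_integrable (w :: real \<Rightarrow> real)"
  shows "dyadic_integrable (\<lambda>x. haar J x * of_real (w x))"
  unfolding dyadic_integrable_def set_integrable_def
proof
  fix I assume I: "I \<in> dyadic"
  have s: "set_integrable lebesgue (right_half J \<inter> I) w" "set_integrable lebesgue (left_half J \<inter> I) w"
    using I half_dyadic[OF J] by (auto intro!: set_integrable_subset[OF dyadic_integrableD[OF w I]] sets.Int)
  have e: "indicator I x *\<^sub>R (haar J x * of_real (w x)) =
    (of_real (indicator (right_half J \<inter> I) x *\<^sub>R w x) - of_real (indicator (left_half J \<inter> I) x *\<^sub>R w x)) / of_real (sqrt (ilen J))" for x
    by (auto simp: haar_def field_simps split: split_indicator)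
  show "integrable lebesgue (\<lambda>x. indicator I x *\<^sub>R (haar J x * of_real (w x)))"
    unfolding e using s by (intro integrable_divide Bochner_Integration.integrable_diff integrable_of_real) (auto simp: set_integrable_def)
qed

lemma dyadic_integrable_sum:
  assumes "\<And>i. i \<in> S \<Longrightarrow> dyadic_integrable (u i)"
  shows "dyadic_integrable (\<lambda>x. \<Sum>i\<in>S. u i x)"
  using assms unfolding dyadic_integrable_def set_integrable_def scaleR_sum_right
  by (intro ballI Bochner_Integration.integrable_sum) auto

lemma dyadic_integrable_mult_left:
  fixes u :: "real \<Rightarrow> complex"
  assumes "dyadic_integrable u" shows "dyadic_integrable (\<lambda>x. a * u x)"
  using assms unfolding dyadic_integrable_def by (auto intro: set_integrable_mult_right)

text \<open>The duality argument, with the explicit test function \<open>g = h w\<close>.  It leads to an inequality of the form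
\<open>N^2 \<le> 2 k ||f|| N\<close> for the norm \<open>N\<close> of \<open>h\<close>.\<close>

lemma paraproduct_sum_bound:
  fixes m n :: nat
  assumes w: "w \<in> A2d" and b: "b \<in> BMOd" and c: "admissible_coeffs m n c" and f: "f \<in> L2w w"
    and L: "finite \<L>" "\<L> \<subseteq> dyadic"
  defines "h \<equiv> \<lambda>x. \<Sum>L\<in>\<L>. paraproduct_term m n c b f L x"
  shows "h \<in> L2w w"
    "L2w_norm w h \<le> 2048 * real (m + n + 2) * A2_char w * BMO_norm b * L2w_norm w f"
proof -
  note W = A2d_properties[OF w]
  let ?\<beta> = "\<lambda>I. cmod (pairing b (haar I))"
  define g where "g x = h x * of_real (w x)" for x
  define a where "a L I J = c L I J * mean I f * pairing b (haar I)" for L I J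
  have dJ: "J \<in> dyadic" if "J \<in> dyadic_gen k L" for J k L using that by (auto dest: dyadic_genD)
  have h: "h x = (\<Sum>L\<in>\<L>. \<Sum>I\<in>dyadic_gen n L. \<Sum>J\<in>dyadic_gen m L. a L I J * haar J x)" for x
    by (simp add: h_def paraproduct_term_def a_def)
  have hm[measurable]: "h \<in> borel_measurable lebesgue"
    unfolding h[abs_def] using dJ by (intro borel_measurable_sum borel_measurable_times haar_measurable borel_measurable_const) auto
  have gi: "dyadic_integrable g"
    unfolding g_def[abs_def] h sum_distrib_right mult.assoc
    using dJ W(3) by (intro dyadic_integrable_sum dyadic_integrable_mult_left dyadic_integrable_haar_mult) auto
  have hg: "h x * cnj (g x) = (\<Sum>L\<in>\<L>. \<Sum>I\<in>dyadic_gen n L. \<Sum>J\<in>dyadic_gen m L. a L I J * (haar J x * cnj (g x)))" for x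
    unfolding h sum_distrib_right mult.assoc ..
  have sq: "h x * cnj (g x) = of_real ((cmod (h x))\<^sup>2 * w x)" for x
  proof -
    have "h x * cnj (g x) = h x * cnj (h x) * of_real (w x)" by (simp add: g_def)
    then show ?thesis unfolding complex_norm_square[symmetric] by simp
  qed
  have hi: "integrable lebesgue (\<lambda>x. h x * cnj (g x))"
    unfolding hg using dJ gi
    by (intro Bochner_Integration.integrable_sum integrable_mult_right integral_haar_cnj(1)) auto
  have "integrable lebesgue (\<lambda>x. Re (h x * cnj (g x)))" by (rule integrable_Re[OF hi])
  then have int: "integrable lebesgue (\<lambda>x. (cmod (h x))\<^sup>2 * w x)" unfolding sq by simp
  then show "h \<in> L2w w" using hm by (simp add: L2w_def)
  have gq: "(cmod (g x))\<^sup>2 * inverse (w x) = (cmod (h x))\<^sup>2 * w x" for x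
  proof -
    have "(cmod (g x))\<^sup>2 = (cmod (h x))\<^sup>2 * (w x)\<^sup>2"
      by (simp add: g_def norm_mult power_mult_distrib)
    then show ?thesis by (cases "w x = 0") (simp_all add: power2_eq_square[of "w x"])
  qed
  have nn: "0 \<le> (LINT x|lebesgue. (cmod (u x))\<^sup>2 * w x)" for u :: "real \<Rightarrow> complex"
    using W(2) by (intro integral_nonneg_AE) (auto elim!: eventually_mono)
  have norm2: "(L2w_norm w u)\<^sup>2 = (LINT x|lebesgue. (cmod (u x))\<^sup>2 * w x)" for u
    using nn[of u] by (simp add: L2w_norm_def)
  let ?u = "\<lambda>I. cmod (mean I f) * ?\<beta> I" and ?v = "\<lambda>J. cmod (pairing g (haar J))"
  have "(L2w_norm w h)\<^sup>2 = cmod (LINT x|lebesgue. h x * cnj (g x))"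
    unfolding sq integral_complex_of_real norm2 using nn[of h] by simp
  also have "(LINT x|lebesgue. h x * cnj (g x)) =
      (\<Sum>L\<in>\<L>. \<Sum>I\<in>dyadic_gen n L. \<Sum>J\<in>dyadic_gen m L. a L I J * cnj (pairing g (haar J)))"
  proof -
    have "(LINT x|lebesgue. h x * cnj (g x)) =
      (\<Sum>L\<in>\<L>. LINT x|lebesgue. (\<Sum>I\<in>dyadic_gen n L. \<Sum>J\<in>dyadic_gen m L. a L I J * (haar J x * cnj (g x))))"
      unfolding hg using dJ gi
      by (intro Bochner_Integration.integral_sum Bochner_Integration.integrable_sum integrable_mult_right integral_haar_cnj(1)) auto
    also have "\<dots> = (\<Sum>L\<in>\<L>. \<Sum>I\<in>dyadic_gen n L. LINT x|lebesgue. (\<Sum>J\<in>dyadic_gen m L. a L I J * (haar J x * cnj (g x))))"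
      using dJ gi
      by (intro sum.cong refl Bochner_Integration.integral_sum Bochner_Integration.integrable_sum integrable_mult_right integral_haar_cnj(1)) auto
    also have "\<dots> = (\<Sum>L\<in>\<L>. \<Sum>I\<in>dyadic_gen n L. \<Sum>J\<in>dyadic_gen m L. LINT x|lebesgue. a L I J * (haar J x * cnj (g x)))"
      using dJ gi
      by (intro sum.cong refl Bochner_Integration.integral_sum integrable_mult_right integral_haar_cnj(1)) auto
    also have "\<dots> = (\<Sum>L\<in>\<L>. \<Sum>I\<in>dyadic_gen n L. \<Sum>J\<in>dyadic_gen m L. a L I J * cnj (pairing g (haar J)))"
      using dJ gi by (intro sum.cong refl) (simp add: integral_haar_cnj(2))
    finally show ?thesis .
  qed
  also have "cmod \<dots> \<le> (\<Sum>L\<in>\<L>. \<Sum>I\<in>dyadic_gen n L. \<Sum>J\<in>dyadic_gen m L. cmod (a L I J * cnj (pairing g (haar J))))"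
    by (intro order_trans[OF norm_sum] sum_mono order_refl)
  also have "\<dots> \<le> (\<Sum>L\<in>\<L>. \<Sum>I\<in>dyadic_gen n L. \<Sum>J\<in>dyadic_gen m L.
      (sqrt (ilen I) * ?u I / sqrt (ilen L)) * (sqrt (ilen J) * ?v J / sqrt (ilen L)))"
  proof (intro sum_mono)
    fix L I J assume H: "L \<in> \<L>" "I \<in> dyadic_gen n L" "J \<in> dyadic_gen m L"
    have Ly: "L \<in> dyadic" using H L by auto
    have "cmod (c L I J) \<le> sqrt (ilen I * ilen J) / ilen L"
      using c H Ly by (auto simp: admissible_coeffs_def)
    also have "\<dots> = (sqrt (ilen I) / sqrt (ilen L)) * (sqrt (ilen J) / sqrt (ilen L))"
      using ilen_pos[OF Ly] by (simp add: real_sqrt_mult)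
    finally have "cmod (c L I J) * (?u I * ?v J) \<le> (sqrt (ilen I) / sqrt (ilen L)) * (sqrt (ilen J) / sqrt (ilen L)) * (?u I * ?v J)"
      by (intro mult_right_mono) auto
    then show "cmod (a L I J * cnj (pairing g (haar J))) \<le>
      (sqrt (ilen I) * ?u I / sqrt (ilen L)) * (sqrt (ilen J) * ?v J / sqrt (ilen L))"
      by (simp add: a_def norm_mult mult_ac)
  qed
  also have "\<dots> = (\<Sum>L\<in>\<L>. scale_coef n ?u L * scale_coef m ?v L)"
    by (simp add: scale_coef_def sum_product sum_divide_distrib)
  finally have dual: "(L2w_norm w h)\<^sup>2 \<le> (\<Sum>L\<in>\<L>. scale_coef n ?u L * scale_coef m ?v L)" .
  have B0: "0 \<le> BMO_norm b" by (simp add: BMO_norm_def)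
  define k where "k = 1024 * real (m + n + 2) * BMO_norm b * A2_char w"
  have k0: "0 \<le> k" using B0 W(6) by (simp add: k_def)
  have N0: "0 \<le> L2w_norm w u" for u using nn[of u] by (simp add: L2w_norm_def)
  have "(L2w_norm w h)\<^sup>2 \<le> k * (s * (L2w_norm w f)\<^sup>2 + (L2w_norm w h)\<^sup>2 / s)" if s: "0 < s" for s
  proof -
    have "(\<Sum>L\<in>\<L>. scale_coef n ?u L * scale_coef m ?v L) \<le>
      k * (s * (LINT x|lebesgue. (cmod (f x))\<^sup>2 * w x) + (LINT x|lebesgue. (cmod (g x))\<^sup>2 * inverse (w x)) / s)"
      unfolding k_def
      by (rule bilinear_estimate[OF W(3,4,2,5,6) _ B0 BMOd_carleson[OF b] _ _ gi _ L s])
        (use L2w_dyadic_integrable[OF w f] f int in \<open>auto simp: gq L2w_def\<close>)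
    then show ?thesis using dual unfolding gq norm2 by simp
  qed
  then have "(L2w_norm w h)\<^sup>2 \<le> 2 * k * L2w_norm w f * L2w_norm w h"
    by (rule le_geometric_mean_if_le_scaled) (use k0 N0 in auto)
  then have "L2w_norm w h * L2w_norm w h \<le> L2w_norm w h * (2 * k * L2w_norm w f)"
    by (simp add: power2_eq_square mult_ac)
  then have "L2w_norm w h \<le> 2 * k * L2w_norm w f"
    using N0[of h] N0[of f] k0 by (cases "L2w_norm w h = 0") (auto simp: mult_le_cancel_left)
  also have "2 * k = 2048 * real (m + n + 2) * A2_char w * BMO_norm b" by (simp add: k_def)
  finally show "L2w_norm w h \<le> 2048 * real (m + n + 2) * A2_char w * BMO_norm b * L2w_norm w f" .
qed

section \<open>Unconditional convergence in the weighted space\<close>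

lemma L2w_norm_nonneg:
  assumes "w \<in> A2d" shows "0 \<le> L2w_norm w u"
  unfolding L2w_norm_def using A2d_properties(2)[OF assms]
  by (intro real_sqrt_ge_zero integral_nonneg_AE) (auto elim!: eventually_mono)

lemma L2w_norm_square:
  assumes "w \<in> A2d" shows "(L2w_norm w u)\<^sup>2 = (LINT x|lebesgue. (cmod (u x))\<^sup>2 * w x)"
proof -
  have "0 \<le> (LINT x|lebesgue. (cmod (u x))\<^sup>2 * w x)"
    using A2d_properties(2)[OF assms] by (intro integral_nonneg_AE) (auto elim!: eventually_mono)
  then show ?thesis by (simp add: L2w_norm_def)
qed

lemma L2w_cmult:
  assumes "u \<in> L2w w"
  shows "(\<lambda>x. a * u x) \<in> L2w w"
proof -
  have "(cmod (a * u x))\<^sup>2 * w x = (cmod a)\<^sup>2 * ((cmod (u x))\<^sup>2 * w x)" for x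
    by (simp add: norm_mult power_mult_distrib)
  then have "integrable lebesgue (\<lambda>x. (cmod (a * u x))\<^sup>2 * w x)"
    using assms by (simp only: L2w_def mem_Collect_eq integrable_mult_right)
  then show ?thesis using assms by (auto simp: L2w_def)
qed

lemma L2w_norm_uminus: "L2w_norm w (\<lambda>x. - u x) = L2w_norm w u"
  by (simp add: L2w_norm_def)

lemma L2w_add:
  assumes w: "w \<in> A2d" and u: "u \<in> L2w w" and v: "v \<in> L2w w"
  shows "(\<lambda>x. u x + v x) \<in> L2w w"
proof -
  have m: "u \<in> borel_measurable lebesgue" "v \<in> borel_measurable lebesgue"
    and i: "integrable lebesgue (\<lambda>x. (cmod (u x))\<^sup>2 * w x)" "integrable lebesgue (\<lambda>x. (cmod (v x))\<^sup>2 * w x)"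
    using u v by (auto simp: L2w_def)
  have "integrable lebesgue (\<lambda>x. (cmod (u x + v x))\<^sup>2 * w x)"
  proof (rule Bochner_Integration.integrable_bound)
    show "integrable lebesgue (\<lambda>x. 2 * ((cmod (u x))\<^sup>2 * w x) + 2 * ((cmod (v x))\<^sup>2 * w x))"
      using i by auto
    show "(\<lambda>x. (cmod (u x + v x))\<^sup>2 * w x) \<in> borel_measurable lebesgue"
      using m A2d_properties(1)[OF w]
      by (intro borel_measurable_times borel_measurable_power borel_measurable_norm borel_measurable_add) auto
    show "AE x in lebesgue. norm ((cmod (u x + v x))\<^sup>2 * w x) \<le> norm (2 * ((cmod (u x))\<^sup>2 * w x) + 2 * ((cmod (v x))\<^sup>2 * w x))"
      using A2d_properties(2)[OF w]
    proof eventually_elim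
      case (elim x)
      have "(cmod (u x + v x))\<^sup>2 \<le> 2 * (cmod (u x))\<^sup>2 + 2 * (cmod (v x))\<^sup>2"
        using cmod_diff_square[of "u x" "v x"] zero_le_power2[of "cmod (u x - v x)"] by linarith
      then have "(cmod (u x + v x))\<^sup>2 * w x \<le> (2 * (cmod (u x))\<^sup>2 + 2 * (cmod (v x))\<^sup>2) * w x"
        using elim by (intro mult_right_mono) auto
      then show ?case using elim by (simp add: algebra_simps)
    qed
  qed
  then show ?thesis using m by (simp add: L2w_def)
qed

lemma L2w_uminus: "u \<in> L2w w \<Longrightarrow> (\<lambda>x. - u x) \<in> L2w w"
  by (auto simp: L2w_def)

lemma L2w_diff:
  assumes "w \<in> A2d" "u \<in> L2w w" "v \<in> L2w w"
  shows "(\<lambda>x. u x - v x) \<in> L2w w"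
  using L2w_add[OF assms(1,2) L2w_uminus[OF assms(3)]] by simp

lemma L2w_zero: "(\<lambda>x. 0) \<in> L2w w"
  by (simp add: L2w_def)

lemma L2w_sum:
  assumes "w \<in> A2d" "finite S" "\<And>i. i \<in> S \<Longrightarrow> u i \<in> L2w w"
  shows "(\<lambda>x. \<Sum>i\<in>S. u i x) \<in> L2w w"
  using assms(2,3)
proof (induction S rule: finite_induct)
  case empty then show ?case by (simp add: L2w_zero)
next
  case (insert i S)
  then show ?case using L2w_add[OF assms(1), of "u i" "\<lambda>x. \<Sum>i\<in>S. u i x"] by simp
qed

lemma L2w_parallelogram:
  assumes w: "w \<in> A2d" and u: "u \<in> L2w w" and v: "v \<in> L2w w"
  shows "(L2w_norm w (\<lambda>x. u x + v x))\<^sup>2 + (L2w_norm w (\<lambda>x. u x - v x))\<^sup>2 = 2 * (L2w_norm w u)\<^sup>2 + 2 * (L2w_norm w v)\<^sup>2"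
proof -
  have i: "integrable lebesgue (\<lambda>x. (cmod (u x + v x))\<^sup>2 * w x)" "integrable lebesgue (\<lambda>x. (cmod (u x - v x))\<^sup>2 * w x)"
     "integrable lebesgue (\<lambda>x. (cmod (u x))\<^sup>2 * w x)" "integrable lebesgue (\<lambda>x. (cmod (v x))\<^sup>2 * w x)"
    using L2w_add[OF assms] L2w_diff[OF assms] u v by (auto simp: L2w_def)
  have "(LINT x|lebesgue. (cmod (u x + v x))\<^sup>2 * w x) + (LINT x|lebesgue. (cmod (u x - v x))\<^sup>2 * w x) =
    (LINT x|lebesgue. (cmod (u x + v x))\<^sup>2 * w x + (cmod (u x - v x))\<^sup>2 * w x)"
    using i by simp
  also have "\<dots> = (LINT x|lebesgue. 2 * ((cmod (u x))\<^sup>2 * w x) + 2 * ((cmod (v x))\<^sup>2 * w x))"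
    unfolding distrib_right[symmetric] cmod_diff_square by (simp add: algebra_simps)
  also have "\<dots> = 2 * (LINT x|lebesgue. (cmod (u x))\<^sup>2 * w x) + 2 * (LINT x|lebesgue. (cmod (v x))\<^sup>2 * w x)"
    using i by simp
  finally show ?thesis unfolding L2w_norm_square[OF w] .
qed

text \<open>The Cauchy-Schwarz inequality for the cross term results from optimizing \<open>t\<close> in
\<open>(p + q)^2 \<le> (1 + t) p^2 + (1 + 1/t) q^2\<close>.\<close>

lemma L2w_norm_triangle:
  assumes w: "w \<in> A2d" and u: "u \<in> L2w w" and v: "v \<in> L2w w"
  shows "L2w_norm w (\<lambda>x. u x + v x) \<le> L2w_norm w u + L2w_norm w v"
proof -
  let ?N = "L2w_norm w"
  have i: "integrable lebesgue (\<lambda>x. (cmod (u x + v x))\<^sup>2 * w x)"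
     "integrable lebesgue (\<lambda>x. (cmod (u x))\<^sup>2 * w x)" "integrable lebesgue (\<lambda>x. (cmod (v x))\<^sup>2 * w x)"
    using L2w_add[OF assms] u v by (auto simp: L2w_def)
  note sq = L2w_norm_square[OF w]
  have "(?N (\<lambda>x. u x + v x))\<^sup>2 - (?N u)\<^sup>2 - (?N v)\<^sup>2 \<le> 1 * (t * (?N u)\<^sup>2 + (?N v)\<^sup>2 / t)" if t: "0 < t" for t
  proof -
    have "(LINT x|lebesgue. (cmod (u x + v x))\<^sup>2 * w x) \<le>
      (LINT x|lebesgue. (1 + t) * ((cmod (u x))\<^sup>2 * w x) + (1 + 1 / t) * ((cmod (v x))\<^sup>2 * w x))"
    proof (rule integral_mono_AE)
      show "AE x in lebesgue. (cmod (u x + v x))\<^sup>2 * w x \<le> (1 + t) * ((cmod (u x))\<^sup>2 * w x) + (1 + 1 / t) * ((cmod (v x))\<^sup>2 * w x)"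
        using A2d_properties(2)[OF w]
      proof eventually_elim
        case (elim x)
        let ?p = "cmod (u x)" and ?q = "cmod (v x)"
        have "(cmod (u x + v x))\<^sup>2 \<le> (?p + ?q)\<^sup>2" by (intro power_mono norm_triangle_ineq) simp
        also have "\<dots> = (1 + t) * ?p\<^sup>2 + (1 + 1 / t) * ?q\<^sup>2 - (t * ?p - ?q)\<^sup>2 / t"
          using t by (simp add: field_simps power2_eq_square)
        also have "\<dots> \<le> (1 + t) * ?p\<^sup>2 + (1 + 1 / t) * ?q\<^sup>2" using t by simp
        finally have "(cmod (u x + v x))\<^sup>2 * w x \<le> ((1 + t) * ?p\<^sup>2 + (1 + 1 / t) * ?q\<^sup>2) * w x"
          using elim by (intro mult_right_mono) auto
        then show ?case by (simp add: algebra_simps)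
      qed
    qed (use i in auto)
    also have "\<dots> = (1 + t) * (LINT x|lebesgue. (cmod (u x))\<^sup>2 * w x) + (1 + 1 / t) * (LINT x|lebesgue. (cmod (v x))\<^sup>2 * w x)"
      using i by simp
    finally show ?thesis unfolding sq by (simp add: algebra_simps)
  qed
  then have "(?N (\<lambda>x. u x + v x))\<^sup>2 - (?N u)\<^sup>2 - (?N v)\<^sup>2 \<le> 2 * 1 * ?N u * ?N v"
    by (rule le_geometric_mean_if_le_scaled) (use L2w_norm_nonneg[OF w] in auto)
  then have "(?N (\<lambda>x. u x + v x))\<^sup>2 \<le> (?N u + ?N v)\<^sup>2"
    by (simp add: power2_eq_square algebra_simps)
  then show ?thesis by (rule power2_le_imp_le) (use L2w_norm_nonneg[OF w] in auto)
qed

lemma L2w_norm_triangle_diff: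
  assumes w: "w \<in> A2d" and u: "u \<in> L2w w" and v: "v \<in> L2w w" and z: "z \<in> L2w w"
  shows "L2w_norm w (\<lambda>x. u x - z x) \<le> L2w_norm w (\<lambda>x. u x - v x) + L2w_norm w (\<lambda>x. v x - z x)"
  using L2w_norm_triangle[OF w L2w_diff[OF w u v] L2w_diff[OF w v z]] by simp

text \<open>Riesz-Fischer.  The weights \<open>2 ^ k\<close> in front of the squared increments are large enough to force
absolute convergence almost everywhere and small enough to keep the integral finite; Fatou's lemma then
transfers the rate of convergence to the limit.\<close>

lemma L2w_complete:
  fixes s :: "nat \<Rightarrow> real \<Rightarrow> complex"
  assumes w: "w \<in> A2d" and s: "\<And>k. s k \<in> L2w w"
    and d: "\<And>k. L2w_norm w (\<lambda>x. s (Suc k) x - s k x) \<le> (1 / 2) ^ k"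
  obtains g where "g \<in> L2w w" "\<And>k. L2w_norm w (\<lambda>x. g x - s k x) \<le> 2 * (1 / 2) ^ k"
proof -
  note W = A2d_properties[OF w]
  have m: "s k \<in> borel_measurable lebesgue" for k using s[of k] by (simp add: L2w_def)
  have nnint: "(\<integral>\<^sup>+x. ennreal ((cmod (u x))\<^sup>2 * w x) \<partial>lebesgue) = ennreal ((L2w_norm w u)\<^sup>2)" if "u \<in> L2w w" for u
    unfolding L2w_norm_square[OF w]
    by (rule nn_integral_eq_integral) (use that W(2) in \<open>auto simp: L2w_def elim!: eventually_mono\<close>)
  have mw: "(\<lambda>x. ennreal ((cmod (u x))\<^sup>2 * w x)) \<in> borel_measurable lebesgue"
    if "u \<in> borel_measurable lebesgue" for u :: "real \<Rightarrow> complex"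
  proof -
    have "(\<lambda>x. (cmod (u x))\<^sup>2 * w x) \<in> borel_measurable lebesgue"
      using that W(1) by (intro borel_measurable_times borel_measurable_power borel_measurable_norm) auto
    then show ?thesis by (rule measurable_compose[OF _ measurable_ennreal])
  qed
  define D where "D k x = s (Suc k) x - s k x" for k x
  have DL: "D k \<in> L2w w" for k unfolding D_def[abs_def] by (rule L2w_diff[OF w s s])
  have Dm: "D k \<in> borel_measurable lebesgue" for k using DL[of k] by (simp add: L2w_def)
  let ?e = "\<lambda>k x. ennreal (2 ^ k) * ennreal ((cmod (D k x))\<^sup>2 * w x)"
  have "(\<integral>\<^sup>+x. (\<Sum>k. ?e k x) \<partial>lebesgue) = (\<Sum>k. \<integral>\<^sup>+x. ?e k x \<partial>lebesgue)"
    using mw[OF Dm] by (intro nn_integral_suminf) auto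
  also have "\<dots> = (\<Sum>k. ennreal (2 ^ k) * ennreal ((L2w_norm w (D k))\<^sup>2))"
    by (simp add: nn_integral_cmult[OF mw[OF Dm]] nnint[OF DL])
  also have "\<dots> \<le> (\<Sum>k. ennreal ((1 / 2) ^ k))"
  proof (intro suminf_le summableI)
    fix k
    have "(L2w_norm w (D k))\<^sup>2 \<le> ((1 / 2) ^ k)\<^sup>2"
      using d[of k] L2w_norm_nonneg[OF w, of "D k"] by (intro power_mono) (auto simp: D_def[abs_def])
    then have "2 ^ k * (L2w_norm w (D k))\<^sup>2 \<le> 2 ^ k * ((1 / 2) ^ k)\<^sup>2" by simp
    also have "\<dots> = (1 / 2) ^ k" by (simp add: power2_eq_square power_mult_distrib[symmetric] mult.assoc[symmetric])
    finally show "ennreal (2 ^ k) * ennreal ((L2w_norm w (D k))\<^sup>2) \<le> ennreal ((1 / 2) ^ k)"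
      by (simp add: ennreal_mult[symmetric] ennreal_leI)
  qed
  also have "\<dots> = ennreal (\<Sum>k. (1 / 2) ^ k)"
    by (rule suminf_ennreal2) (auto intro: summable_geometric)
  also have "\<dots> < \<infinity>" by simp
  finally have fin: "(\<integral>\<^sup>+x. (\<Sum>k. ?e k x) \<partial>lebesgue) \<noteq> \<infinity>" by simp
  have "AE x in lebesgue. (\<Sum>k. ?e k x) \<noteq> \<infinity>"
    by (rule nn_integral_PInf_AE[OF _ fin]) (use mw[OF Dm] in auto)
  then have conv: "AE x in lebesgue. convergent (\<lambda>k. s k x)"
    using W(2)
  proof eventually_elim
    case (elim x)
    have "summable (\<lambda>k. 2 ^ k * ((cmod (D k x))\<^sup>2 * w x))"
      using elim by (intro summable_suminf_not_top) (auto simp: ennreal_mult)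
    from summable_mult[OF this, of "inverse (w x)"] have "summable (\<lambda>k. 2 ^ k * (cmod (D k x))\<^sup>2)"
      using elim(2) by (simp add: field_simps)
    then have "summable (\<lambda>k. 2 ^ k * (cmod (D k x))\<^sup>2 + (1 / 2) ^ k)"
      by (intro summable_add summable_geometric) auto
    then have "summable (\<lambda>k. D k x)"
    proof (rule summable_comparison_test'[where N = 0])
      fix k
      have "2 ^ k * (cmod (D k x))\<^sup>2 + (1 / 2) ^ k - 2 * cmod (D k x) = (2 ^ k * cmod (D k x) - 1)\<^sup>2 / 2 ^ k"
        by (simp add: field_simps power2_eq_square power_divide)
      also have "\<dots> \<ge> 0" by simp
      finally show "norm (D k x) \<le> 2 ^ k * (cmod (D k x))\<^sup>2 + (1 / 2) ^ k"
        using norm_ge_zero[of "D k x"] by linarith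
    qed
    then have "convergent (\<lambda>n. s 0 x + (\<Sum>k<n. D k x))"
      by (intro convergent_add convergent_const) (simp add: summable_iff_convergent)
    moreover have "s 0 x + (\<Sum>k<n. D k x) = s n x" for n
      unfolding D_def by (subst sum_lessThan_telescope) simp
    ultimately show "convergent (\<lambda>k. s k x)" by simp
  qed
  define g where "g x = lim (\<lambda>k. s k x)" for x
  have gm: "g \<in> borel_measurable lebesgue"
    unfolding g_def[abs_def] by (rule borel_measurable_lim_metric[OF m])
  have lim: "AE x in lebesgue. (\<lambda>k. s k x) \<longlonglongrightarrow> g x"
    using conv by eventually_elim (simp add: g_def convergent_LIMSEQ_iff)
  have step: "L2w_norm w (\<lambda>x. s (k + i) x - s k x) \<le> 2 * (1 / 2) ^ k - 2 * (1 / 2) ^ (k + i)" for k i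
  proof (induction i)
    case 0 show ?case by (simp add: L2w_norm_def)
  next
    case (Suc i)
    have "L2w_norm w (\<lambda>x. s (k + Suc i) x - s k x) \<le>
      L2w_norm w (\<lambda>x. s (k + Suc i) x - s (k + i) x) + L2w_norm w (\<lambda>x. s (k + i) x - s k x)"
      by (rule L2w_norm_triangle_diff[OF w s s s])
    also have "\<dots> \<le> (1 / 2) ^ (k + i) + (2 * (1 / 2) ^ k - 2 * (1 / 2) ^ (k + i))"
      using d[of "k + i"] Suc by (intro add_mono) auto
    finally show ?case by simp
  qed
  have fatou: "(\<integral>\<^sup>+x. ennreal ((cmod (g x - s k x))\<^sup>2 * w x) \<partial>lebesgue) \<le> ennreal ((2 * (1 / 2) ^ k)\<^sup>2)" for k
  proof -
    have "(\<integral>\<^sup>+x. ennreal ((cmod (g x - s k x))\<^sup>2 * w x) \<partial>lebesgue) =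
      (\<integral>\<^sup>+x. liminf (\<lambda>i. ennreal ((cmod (s (k + i) x - s k x))\<^sup>2 * w x)) \<partial>lebesgue)"
    proof (rule nn_integral_cong_AE)
      show "AE x in lebesgue. ennreal ((cmod (g x - s k x))\<^sup>2 * w x) =
        liminf (\<lambda>i. ennreal ((cmod (s (k + i) x - s k x))\<^sup>2 * w x))"
        using lim
      proof eventually_elim
        case (elim x)
        from LIMSEQ_ignore_initial_segment[OF elim, of k]
        have "(\<lambda>i. s (k + i) x) \<longlonglongrightarrow> g x" by (simp add: add.commute)
        then have "(\<lambda>i. ennreal ((cmod (s (k + i) x - s k x))\<^sup>2 * w x)) \<longlonglongrightarrow> ennreal ((cmod (g x - s k x))\<^sup>2 * w x)"
          by (intro tendsto_intros)
        from lim_imp_Liminf[OF _ this] show ?case by simp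
      qed
    qed
    also have "\<dots> \<le> liminf (\<lambda>i. \<integral>\<^sup>+x. ennreal ((cmod (s (k + i) x - s k x))\<^sup>2 * w x) \<partial>lebesgue)"
      using m by (intro nn_integral_liminf mw borel_measurable_diff) auto
    also have "\<dots> = liminf (\<lambda>i. ennreal ((L2w_norm w (\<lambda>x. s (k + i) x - s k x))\<^sup>2))"
      by (simp add: nnint[OF L2w_diff[OF w s s]])
    also have "\<dots> \<le> liminf (\<lambda>i::nat. ennreal ((2 * (1 / 2) ^ k)\<^sup>2))"
    proof (intro Liminf_mono always_eventually allI ennreal_leI power_mono)
      fix i
      have "(0::real) \<le> 2 * (1 / 2) ^ (k + i)" by simp
      then show "L2w_norm w (\<lambda>x. s (k + i) x - s k x) \<le> 2 * (1 / 2) ^ k" using step[of k i] by linarith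
    qed (rule L2w_norm_nonneg[OF w])
    also have "\<dots> = ennreal ((2 * (1 / 2) ^ k)\<^sup>2)" by (simp add: Liminf_const)
    finally show ?thesis .
  qed
  have gs: "(\<lambda>x. g x - s k x) \<in> L2w w" for k
  proof -
    have "integrable lebesgue (\<lambda>x. (cmod (g x - s k x))\<^sup>2 * w x)"
    proof (rule integrableI_nonneg)
      show "(\<lambda>x. (cmod (g x - s k x))\<^sup>2 * w x) \<in> borel_measurable lebesgue"
        using gm m W(1) by (intro borel_measurable_times borel_measurable_power borel_measurable_norm borel_measurable_diff) auto
      show "AE x in lebesgue. 0 \<le> (cmod (g x - s k x))\<^sup>2 * w x" using W(2) by (auto elim!: eventually_mono)
      show "(\<integral>\<^sup>+x. ennreal ((cmod (g x - s k x))\<^sup>2 * w x) \<partial>lebesgue) < \<infinity>"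
        by (rule le_less_trans[OF fatou]) simp
    qed
    then show ?thesis using gm m by (auto simp: L2w_def)
  qed
  show thesis
  proof (rule that)
    show "g \<in> L2w w" using L2w_add[OF w gs[of 0] s[of 0]] by simp
    fix k
    have "ennreal ((L2w_norm w (\<lambda>x. g x - s k x))\<^sup>2) \<le> ennreal ((2 * (1 / 2) ^ k)\<^sup>2)"
      using fatou[of k] unfolding nnint[OF gs] .
    then have "(L2w_norm w (\<lambda>x. g x - s k x))\<^sup>2 \<le> (2 * (1 / 2) ^ k)\<^sup>2" by (subst (asm) ennreal_le_iff) auto
    then show "L2w_norm w (\<lambda>x. g x - s k x) \<le> 2 * (1 / 2) ^ k"
      by (rule power2_le_imp_le) simp
  qed
qed

text \<open>If no finite set \<open>F0\<close> existed, disjoint blocks of norm greater than \<open>e\<close> could be added one after the other.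
By the parallelogram law one of the two signs of each new block increases the square of the norm by at least
\<open>e^2\<close>, and after finitely many steps the bound \<open>M\<close> is violated.\<close>

lemma unconditional_tail:
  fixes X :: "'i \<Rightarrow> real \<Rightarrow> complex"
  assumes w: "w \<in> A2d" and X: "\<And>i. i \<in> D \<Longrightarrow> X i \<in> L2w w"
    and bound: "\<And>F \<epsilon>. finite F \<Longrightarrow> F \<subseteq> D \<Longrightarrow> (\<And>i. \<epsilon> i \<in> {1, - 1 :: complex}) \<Longrightarrow>
      L2w_norm w (\<lambda>x. \<Sum>i\<in>F. \<epsilon> i * X i x) \<le> M"
    and e: "0 < e"
  shows "\<exists>F0. finite F0 \<and> F0 \<subseteq> D \<and> (\<forall>F. finite F \<longrightarrow> F \<subseteq> D \<longrightarrow> F \<inter> F0 = {} \<longrightarrow> L2w_norm w (\<lambda>x. \<Sum>i\<in>F. X i x) \<le> e)"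
proof (rule ccontr)
  assume no: "\<not> ?thesis"
  have step: "\<exists>F \<epsilon>. finite F \<and> F \<subseteq> D \<and> (\<forall>i. \<epsilon> i \<in> {1, - 1 :: complex}) \<and>
    real k * e\<^sup>2 \<le> (L2w_norm w (\<lambda>x. \<Sum>i\<in>F. \<epsilon> i * X i x))\<^sup>2" for k
  proof (induction k)
    case 0
    show ?case by (intro exI[of _ "{}"] exI[of _ "\<lambda>_. 1"]) auto
  next
    case (Suc k)
    then obtain F \<epsilon> where F: "finite F" "F \<subseteq> D" and eps: "\<And>i. \<epsilon> i \<in> {1, - 1 :: complex}"
      and k: "real k * e\<^sup>2 \<le> (L2w_norm w (\<lambda>x. \<Sum>i\<in>F. \<epsilon> i * X i x))\<^sup>2" by blast
    obtain G where G: "finite G" "G \<subseteq> D" "G \<inter> F = {}" and big: "e < L2w_norm w (\<lambda>x. \<Sum>i\<in>G. X i x)"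
      using no F by (metis not_le)
    define u v where "u x = (\<Sum>i\<in>F. \<epsilon> i * X i x)" and "v x = (\<Sum>i\<in>G. X i x)" for x
    have u: "u \<in> L2w w" unfolding u_def[abs_def] using F X by (intro L2w_sum[OF w] L2w_cmult) auto
    have v: "v \<in> L2w w" unfolding v_def[abs_def] using G X by (intro L2w_sum[OF w]) auto
    have par: "(L2w_norm w (\<lambda>x. u x + v x))\<^sup>2 + (L2w_norm w (\<lambda>x. u x - v x))\<^sup>2 = 2 * (L2w_norm w u)\<^sup>2 + 2 * (L2w_norm w v)\<^sup>2"
      by (rule L2w_parallelogram[OF w u v])
    have "e\<^sup>2 \<le> (L2w_norm w v)\<^sup>2" using big e by (intro power_mono) (auto simp: v_def[abs_def])
    then have sum: "real (Suc k) * e\<^sup>2 \<le> (L2w_norm w u)\<^sup>2 + (L2w_norm w v)\<^sup>2"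
      using k by (simp add: u_def[abs_def] algebra_simps)
    obtain t where t: "t \<in> {1, - 1 :: complex}" and ge: "real (Suc k) * e\<^sup>2 \<le> (L2w_norm w (\<lambda>x. u x + t * v x))\<^sup>2"
    proof (cases "real (Suc k) * e\<^sup>2 \<le> (L2w_norm w (\<lambda>x. u x + v x))\<^sup>2")
      case True
      then show thesis by (intro that[of 1]) auto
    next
      case False
      then have "real (Suc k) * e\<^sup>2 \<le> (L2w_norm w (\<lambda>x. u x - v x))\<^sup>2" using par sum by linarith
      then show thesis by (intro that[of "- 1"]) auto
    qed
    define \<epsilon>' where "\<epsilon>' i = (if i \<in> F then \<epsilon> i else t)" for i
    have "u x + t * v x = (\<Sum>i\<in>F \<union> G. \<epsilon>' i * X i x)" for x
    proof -
      have "(\<Sum>i\<in>F \<union> G. \<epsilon>' i * X i x) = (\<Sum>i\<in>F. \<epsilon>' i * X i x) + (\<Sum>i\<in>G. \<epsilon>' i * X i x)"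
        using F G by (intro sum.union_disjoint) auto
      also have "(\<Sum>i\<in>F. \<epsilon>' i * X i x) = u x" by (simp add: u_def \<epsilon>'_def)
      also have "(\<Sum>i\<in>G. \<epsilon>' i * X i x) = (\<Sum>i\<in>G. t * X i x)"
        using G(3) by (intro sum.cong refl) (auto simp: \<epsilon>'_def)
      finally show ?thesis by (simp add: v_def sum_distrib_left)
    qed
    then show ?case
      using ge F G t eps by (intro exI[of _ "F \<union> G"] exI[of _ \<epsilon>']) (auto simp: \<epsilon>'_def)
  qed
  obtain k :: nat where "M\<^sup>2 / e\<^sup>2 < real k" using reals_Archimedean2 by blast
  then have k: "M\<^sup>2 < real k * e\<^sup>2" using e by (simp add: field_simps)
  obtain F \<epsilon> where F: "finite F" "F \<subseteq> D" "\<forall>i. \<epsilon> i \<in> {1, - 1 :: complex}"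
    and ge: "real k * e\<^sup>2 \<le> (L2w_norm w (\<lambda>x. \<Sum>i\<in>F. \<epsilon> i * X i x))\<^sup>2" using step[of k] by blast
  have "(L2w_norm w (\<lambda>x. \<Sum>i\<in>F. \<epsilon> i * X i x))\<^sup>2 \<le> M\<^sup>2"
    using bound[OF F(1,2)] F(3) L2w_norm_nonneg[OF w] by (intro power_mono) auto
  then show False using k ge by linarith
qed

lemma unconditional_convergence:
  fixes X :: "'i \<Rightarrow> real \<Rightarrow> complex"
  assumes w: "w \<in> A2d" and X: "\<And>i. i \<in> D \<Longrightarrow> X i \<in> L2w w"
    and bound: "\<And>F \<epsilon>. finite F \<Longrightarrow> F \<subseteq> D \<Longrightarrow> (\<And>i. \<epsilon> i \<in> {1, - 1 :: complex}) \<Longrightarrow>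
      L2w_norm w (\<lambda>x. \<Sum>i\<in>F. \<epsilon> i * X i x) \<le> M"
  shows "\<exists>g\<in>L2w w. ((\<lambda>F. L2w_norm w (\<lambda>x. g x - (\<Sum>i\<in>F. X i x))) \<longlongrightarrow> 0) (finite_subsets_at_top D)"
proof -
  let ?S = "\<lambda>F x. \<Sum>i\<in>F. X i x"
  have SL: "?S F \<in> L2w w" if "finite F" "F \<subseteq> D" for F using that X by (intro L2w_sum[OF w]) auto
  have "\<forall>k::nat. \<exists>F0. finite F0 \<and> F0 \<subseteq> D \<and> (\<forall>F. finite F \<longrightarrow> F \<subseteq> D \<longrightarrow> F \<inter> F0 = {} \<longrightarrow> L2w_norm w (?S F) \<le> (1 / 2) ^ k)"
    by (intro allI unconditional_tail[OF w X bound]) auto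
  then obtain H where H: "\<And>k::nat. finite (H k)" "\<And>k. H k \<subseteq> D"
    "\<And>k F. finite F \<Longrightarrow> F \<subseteq> D \<Longrightarrow> F \<inter> H k = {} \<Longrightarrow> L2w_norm w (?S F) \<le> (1 / 2) ^ k" by metis
  define G where "G k = (\<Union>i\<le>k. H i)" for k
  have G: "finite (G k)" "G k \<subseteq> D" "H k \<subseteq> G k" "G k \<subseteq> G (Suc k)" for k
    using H(1,2) by (auto simp: G_def atMost_Suc)
  have tail: "L2w_norm w (\<lambda>x. ?S F x - ?S (G k) x) \<le> (1 / 2) ^ k" if "finite F" "F \<subseteq> D" "G k \<subseteq> F" for F k
  proof -
    have "?S F x - ?S (G k) x = ?S (F - G k) x" for x using that G(1) by (simp add: sum_diff)
    then show ?thesis using H(3)[of "F - G k" k] that G(3)[of k] by auto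
  qed
  obtain g where g: "g \<in> L2w w" "\<And>k. L2w_norm w (\<lambda>x. g x - ?S (G k) x) \<le> 2 * (1 / 2) ^ k"
    by (rule L2w_complete[OF w, of "\<lambda>k. ?S (G k)"]) (use SL G tail in auto)
  have near: "L2w_norm w (\<lambda>x. g x - ?S F x) \<le> 3 * (1 / 2) ^ k" if F: "finite F" "F \<subseteq> D" "G k \<subseteq> F" for F k
  proof -
    have "L2w_norm w (\<lambda>x. g x - ?S F x) \<le> L2w_norm w (\<lambda>x. g x - ?S (G k) x) + L2w_norm w (\<lambda>x. ?S (G k) x - ?S F x)"
      by (rule L2w_norm_triangle_diff[OF w g(1) SL SL]) (use F G in auto)
    also have "L2w_norm w (\<lambda>x. ?S (G k) x - ?S F x) = L2w_norm w (\<lambda>x. ?S F x - ?S (G k) x)"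
      using L2w_norm_uminus[of w "\<lambda>x. ?S F x - ?S (G k) x"] by simp
    finally show ?thesis using g(2)[of k] tail[OF F] by linarith
  qed
  have "((\<lambda>F. L2w_norm w (\<lambda>x. g x - ?S F x)) \<longlongrightarrow> 0) (finite_subsets_at_top D)"
  proof (rule tendstoI)
    fix e :: real assume e: "0 < e"
    obtain k where k: "(1 / 2) ^ k < e / 3" using real_arch_pow_inv[of "e / 3" "1 / 2"] e by auto
    show "\<forall>\<^sub>F F in finite_subsets_at_top D. dist (L2w_norm w (\<lambda>x. g x - ?S F x)) 0 < e"
      unfolding eventually_finite_subsets_at_top
    proof (intro exI[of _ "G k"] conjI allI impI G)
      fix F assume "finite F \<and> G k \<subseteq> F \<and> F \<subseteq> D"
      then have "L2w_norm w (\<lambda>x. g x - ?S F x) \<le> 3 * (1 / 2) ^ k" using near by blast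
      then show "dist (L2w_norm w (\<lambda>x. g x - ?S F x)) 0 < e"
        using k L2w_norm_nonneg[OF w, of "\<lambda>x. g x - ?S F x"] by (simp add: dist_real_def)
    qed
  qed
  then show ?thesis using g(1) by blast
qed

theorem theorem1p1:
  "\<exists>C>0. \<forall>w\<in>A2d. \<forall>b\<in>BMOd. \<forall>(m::nat) (n::nat) c. admissible_coeffs m n c \<longrightarrow>
     (\<forall>f\<in>L2w w.
        (\<exists>g. is_paraproduct w m n c b f g) \<and>
        (\<forall>g. is_paraproduct w m n c b f g \<longrightarrow>
           L2w_norm w g \<le> C * real (m + n + 2) ^ 5 * A2_char w * BMO_norm b * L2w_norm w f))"
proof (intro exI[of _ 2048] conjI ballI allI impI)
  fix w b m n c f
  assume w: "w \<in> A2d" and b: "b \<in> BMOd" and c: "admissible_coeffs m n c" and f: "f \<in> L2w w"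
  define M where "M = 2048 * real (m + n + 2) * A2_char w * BMO_norm b * L2w_norm w f"
  let ?X = "paraproduct_term m n c b f"
  have XL: "?X L \<in> L2w w" if "L \<in> dyadic" for L
    using paraproduct_sum_bound(1)[OF w b c f, of "{L}"] that by simp
  have bound: "L2w_norm w (\<lambda>x. \<Sum>L\<in>F. \<epsilon> L * ?X L x) \<le> M"
    if F: "finite F" "F \<subseteq> dyadic" and eps: "\<And>L. \<epsilon> L \<in> {1, - 1 :: complex}" for F \<epsilon>
  proof -
    have "cmod (\<epsilon> L) = 1" for L using eps[of L] by auto
    then have "admissible_coeffs m n (\<lambda>L I J. \<epsilon> L * c L I J)"
      using c by (simp add: admissible_coeffs_def norm_mult)
    from paraproduct_sum_bound(2)[OF w b this f F]
    show ?thesis by (simp add: M_def paraproduct_term_def sum_distrib_left mult.assoc)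
  qed
  show "\<exists>g. is_paraproduct w m n c b f g"
    using unconditional_convergence[OF w XL bound] unfolding is_paraproduct_def by blast
  fix g assume "is_paraproduct w m n c b f g"
  then have g: "g \<in> L2w w" and lim: "((\<lambda>F. L2w_norm w (\<lambda>x. g x - (\<Sum>L\<in>F. ?X L x))) \<longlongrightarrow> 0) (finite_subsets_at_top dyadic)"
    by (auto simp: is_paraproduct_def)
  have "L2w_norm w g \<le> M"
  proof (rule tendsto_lowerbound)
    show "((\<lambda>F. L2w_norm w (\<lambda>x. g x - (\<Sum>L\<in>F. ?X L x)) + M) \<longlongrightarrow> M) (finite_subsets_at_top dyadic)"
      using tendsto_add[OF lim tendsto_const[of M]] by simp
    have "L2w_norm w g \<le> L2w_norm w (\<lambda>x. g x - (\<Sum>L\<in>F. ?X L x)) + M" if F: "finite F" "F \<subseteq> dyadic" for F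
    proof -
      have S: "(\<lambda>x. \<Sum>L\<in>F. ?X L x) \<in> L2w w" by (rule paraproduct_sum_bound(1)[OF w b c f F])
      have "L2w_norm w g \<le> L2w_norm w (\<lambda>x. g x - (\<Sum>L\<in>F. ?X L x)) + L2w_norm w (\<lambda>x. \<Sum>L\<in>F. ?X L x)"
        using L2w_norm_triangle[OF w L2w_diff[OF w g S] S] by simp
      also have "L2w_norm w (\<lambda>x. \<Sum>L\<in>F. ?X L x) \<le> M"
        using paraproduct_sum_bound(2)[OF w b c f F] by (simp add: M_def)
      finally show ?thesis by simp
    qed
    then show "\<forall>\<^sub>F F in finite_subsets_at_top dyadic. L2w_norm w g \<le> L2w_norm w (\<lambda>x. g x - (\<Sum>L\<in>F. ?X L x)) + M"
      unfolding eventually_finite_subsets_at_top by auto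
  qed simp
  also have "M \<le> 2048 * real (m + n + 2) ^ 5 * A2_char w * BMO_norm b * L2w_norm w f"
  proof -
    have "real (m + n + 2) ^ 1 \<le> real (m + n + 2) ^ 5" by (intro power_increasing) auto
    then show ?thesis
      unfolding M_def using A2d_properties(6)[OF w] L2w_norm_nonneg[OF w, of f]
      by (intro mult_right_mono mult_left_mono) (auto simp: BMO_norm_def)
  qed
  finally show "L2w_norm w g \<le> 2048 * real (m + n + 2) ^ 5 * A2_char w * BMO_norm b * L2w_norm w f" .
qed simp

end
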